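(* Let $N(\alpha,\beta)$ be a (4-dimensional) generalized complex space form and $M^3$ a hypersurface of $N(\alpha,\beta)$ with non-zero constant mean curvature $H$ and second fundamental form $B$. Then $M$ is proper biharmonic if and only if $$\|B\|^2=3(\alpha+\beta),$$ or equivalently, if and only if the scalar curvature of $M$ satisfies $$\mathrm{Scal}_M=3(\alpha+\beta)+9H^2.$$
   Context: A generalized complex space form is an almost Hermitian manifold $(N,g,J)$ whose curvature tensor has the form $R=\alpha R_1+\beta R_2$, with $\alpha,\beta$ smooth functions on $N$ and $$R_1(X,Y)Z=g(Y,Z)X-g(X,Z)Y,$$ $$R_2(X,Y)Z=g(JY,Z)JX-g(JX,Z)JY+2g(JY,X)JZ.$$ $N(\alpha,\beta)$ denotes such a manifold of real dimension 4. Curvature convention: $R(X,Y)=[\nabla_X,\nabla_Y]-\nabla_{[X,Y]}$. It is known (Tricerri–Vanhecke) that $\alpha+\beta$ is constant; $N(\alpha,\beta)$ is Einstein with constant scalar curvature $12(\alpha+\beta)$. The mean curvature is normalized as $\frac13\mathrm{tr}\,B$; $H^2$ denotes the square of the length of the mean curvature vector, and constant mean curvature means this length is constant. $\mathrm{Scal}_M$ is the sum of $g(R^M(X_i,X_j)X_j,X_i)$ over all $i,j$ for an orthonormal frame. A submanifold given by an isometric immersion $\psi:M\to N$ is biharmonic if $\tau_2(\psi)=0$, where $\tau_2(\psi)=\Delta\tau(\psi)-\mathrm{tr}\big(R^N(d\psi,\tau(\psi))d\psi\big)$, $\tau(\psi)$ is the tension field and $\Delta V=\mathrm{tr}(\nabla^2V)$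 is the rough Laplacian on sections of $\psi^{-1}(TN)$. It is proper biharmonic if it is biharmonic and not harmonic (i.e. not minimal). *)

theory Defs
  imports "HOL-Analysis.Analysis"
begin

section \<open>Smooth functions on open subsets of Euclidean space\<close>

text \<open>These notions are only used for open \<open>S\<close>, so that \<open>at x\<close> and \<open>at x within S\<close> agree.\<close>

primrec Ck_on :: "nat \<Rightarrow> 'a::euclidean_space set \<Rightarrow> ('a \<Rightarrow> 'b::real_normed_vector) \<Rightarrow> bool" where
  "Ck_on 0 S f \<longleftrightarrow> continuous_on S f"
| "Ck_on (Suc k) S f \<longleftrightarrow>
     (\<forall>x\<in>S. f differentiable at x) \<and> (\<forall>v. Ck_on k S (\<lambda>x. frechet_derivative f (at x) v))"

definition smooth_on :: "'a::euclidean_space set \<Rightarrow> ('a \<Rightarrow> 'b::real_normed_vector) \<Rightarrow> bool" where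
  "smooth_on S f \<longleftrightarrow> (\<forall>k. Ck_on k S f)"


section \<open>Riemannian and almost Hermitian manifolds\<close>

text \<open>A chart is a pair of its domain and its coordinate map; the values of the coordinate map
  outside the domain are irrelevant.\<close>

type_synonym ('a, 'n) chart = "'a set \<times> ('a \<Rightarrow> real ^ 'n)"

abbreviation chart_inv :: "('a, 'n::finite) chart \<Rightarrow> real ^ 'n \<Rightarrow> 'a" where
  "chart_inv c \<equiv> inv_into (fst c) (snd c)"

text \<open>A map between manifolds read in charts, and the open coordinate domain where this
  makes sense.\<close>

definition local_rep ::
    "('a, 'm::finite) chart \<Rightarrow> ('b, 'n::finite) chart \<Rightarrow> ('a \<Rightarrow> 'b) \<Rightarrow> real ^ 'm \<Rightarrow> real ^ 'n" where
  "local_rep c d \<psi> = snd d \<circ> \<psi> \<circ> chart_inv c"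

definition local_dom ::
    "('a, 'm::finite) chart \<Rightarrow> ('b, 'n::finite) chart \<Rightarrow> ('a \<Rightarrow> 'b) \<Rightarrow> (real ^ 'm) set" where
  "local_dom c d \<psi> = snd c ` (fst c \<inter> \<psi> -` fst d)"

abbreviation diff_at ::
    "(real ^ 'm::finite \<Rightarrow> real ^ 'n::finite) \<Rightarrow> real ^ 'm \<Rightarrow> real ^ 'm \<Rightarrow> real ^ 'n" where
  "diff_at F x \<equiv> frechet_derivative F (at x)"

text \<open>A tensor field of rank two is the family of its component matrices: \<open>A c x\<close> is the matrix
  in the chart \<open>c\<close> at the point with coordinates \<open>x\<close>. The transformation rules under a change of
  charts (for \<open>(0,2)\<close> and \<open>(1,1)\<close> tensors) are part of the definitions of a Riemannian metric
  and of an almost complex structure below.\<close>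

record ('a, 'n::finite) riemannian =
  mtop :: "'a topology"
  charts :: "('a, 'n) chart set"
  metric :: "('a, 'n) chart \<Rightarrow> real ^ 'n \<Rightarrow> real ^ 'n ^ 'n"

record ('a, 'n::finite) almost_hermitian = "('a, 'n) riemannian" +
  acs :: "('a, 'n) chart \<Rightarrow> real ^ 'n \<Rightarrow> real ^ 'n ^ 'n"

text \<open>Manifolds are nonempty, Hausdorff and second countable, but need not be connected.\<close>

definition smooth_manifold :: "('a, 'n::finite, 'z) riemannian_scheme \<Rightarrow> bool" where
  "smooth_manifold M \<longleftrightarrow>
     topspace (mtop M) \<noteq> {} \<and> Hausdorff_space (mtop M) \<and> second_countable (mtop M) \<and>
     (\<Union>c\<in>charts M. fst c) = topspace (mtop M) \<and>
     (\<forall>c\<in>charts M. openin (mtop M) (fst c) \<and> open (snd c ` fst c) \<and>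
        homeomorphic_map (subtopology (mtop M) (fst c)) (top_of_set (snd c ` fst c)) (snd c)) \<and>
     (\<forall>c\<in>charts M. \<forall>d\<in>charts M. smooth_on (local_dom c d id) (local_rep c d id))"

definition ip :: "real ^ 'n ^ 'n \<Rightarrow> real ^ 'n \<Rightarrow> real ^ 'n \<Rightarrow> real" where
  "ip G u v = u \<bullet> (G *v v)"

definition riemannian_manifold :: "('a, 'n::finite, 'z) riemannian_scheme \<Rightarrow> bool" where
  "riemannian_manifold M \<longleftrightarrow> smooth_manifold M \<and>
     (\<forall>c\<in>charts M. smooth_on (snd c ` fst c) (metric M c)) \<and>
     (\<forall>c\<in>charts M. \<forall>x\<in>snd c ` fst c.
        (\<forall>u v. ip (metric M c x) u v = ip (metric M c x) v u) \<and>
        (\<forall>u. u \<noteq> 0 \<longrightarrow> ip (metric M c x) u u > 0)) \<and>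
     (\<forall>c\<in>charts M. \<forall>d\<in>charts M. \<forall>x\<in>local_dom c d id. \<forall>u v.
        ip (metric M c x) u v =
        ip (metric M d (local_rep c d id x))
           (diff_at (local_rep c d id) x u) (diff_at (local_rep c d id) x v))"

definition almost_hermitian_manifold :: "('a, 'n::finite, 'z) almost_hermitian_scheme \<Rightarrow> bool" where
  "almost_hermitian_manifold N \<longleftrightarrow> riemannian_manifold N \<and>
     (\<forall>c\<in>charts N. smooth_on (snd c ` fst c) (acs N c)) \<and>
     (\<forall>c\<in>charts N. \<forall>x\<in>snd c ` fst c. \<forall>u v.
        acs N c x *v (acs N c x *v u) = - u \<and>
        ip (metric N c x) (acs N c x *v u) (acs N c x *v v) = ip (metric N c x) u v) \<and>
     (\<forall>c\<in>charts N. \<forall>d\<in>charts N. \<forall>x\<in>local_dom c d id. \<forall>u.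
        diff_at (local_rep c d id) x (acs N c x *v u) =
        acs N d (local_rep c d id x) *v diff_at (local_rep c d id) x u)"

definition smooth_function :: "('a, 'n::finite, 'z) riemannian_scheme \<Rightarrow> ('a \<Rightarrow> real) \<Rightarrow> bool" where
  "smooth_function M f \<longleftrightarrow> (\<forall>c\<in>charts M. smooth_on (snd c ` fst c) (f \<circ> chart_inv c))"

definition smooth_map ::
    "('a, 'm::finite, 'y) riemannian_scheme \<Rightarrow> ('b, 'n::finite, 'z) riemannian_scheme
       \<Rightarrow> ('a \<Rightarrow> 'b) \<Rightarrow> bool" where
  "smooth_map M N \<psi> \<longleftrightarrow> continuous_map (mtop M) (mtop N) \<psi> \<and>
     (\<forall>c\<in>charts M. \<forall>d\<in>charts N. smooth_on (local_dom c d \<psi>) (local_rep c d \<psi>))"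

definition isometric_immersion ::
    "('a, 'm::finite, 'y) riemannian_scheme \<Rightarrow> ('b, 'n::finite, 'z) riemannian_scheme
       \<Rightarrow> ('a \<Rightarrow> 'b) \<Rightarrow> bool" where
  "isometric_immersion M N \<psi> \<longleftrightarrow> smooth_map M N \<psi> \<and>
     (\<forall>c\<in>charts M. \<forall>d\<in>charts N. \<forall>x\<in>local_dom c d \<psi>.
        inj (diff_at (local_rep c d \<psi>) x) \<and>
        (\<forall>u v. ip (metric M c x) u v =
           ip (metric N d (local_rep c d \<psi> x))
              (diff_at (local_rep c d \<psi>) x u) (diff_at (local_rep c d \<psi>) x v)))"


section \<open>Local Riemannian geometry\<close>

text \<open>Throughout this section \<open>g\<close> and \<open>h\<close> are the component matrices of a metric on an open set
  of coordinates and \<open>F\<close> is a map between two such sets, the first with the metric \<open>g\<close>, the second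
  with \<open>h\<close>. Everything at \<open>x\<close> depends only on the behaviour near \<open>x\<close>. Where a vector has to be
  extended to a vector field in order to be differentiated, the extension with constant
  coordinates is used; the resulting expressions are tensorial.\<close>

definition orthonormal_frame :: "real ^ 'n ^ 'n \<Rightarrow> ('n::finite \<Rightarrow> real ^ 'n) \<Rightarrow> bool" where
  "orthonormal_frame G E \<longleftrightarrow> (\<forall>i j. ip G (E i) (E j) = (if i = j then 1 else 0))"

text \<open>The sum of \<open>q (E i)\<close> over an orthonormal frame. It is only applied to quadratic \<open>q\<close>, for which
  it does not depend on the frame.\<close>

definition frame_sum :: "real ^ 'n ^ 'n \<Rightarrow> (real ^ 'n::finite \<Rightarrow> 'b::real_vector) \<Rightarrow> 'b" where
  "frame_sum G q = (\<Sum>i\<in>UNIV. q ((SOME E. orthonormal_frame G E) i))"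

text \<open>The Christoffel symbols, \<open>\<Gamma>\<^sup>k\<^sub>i\<^sub>j = 1/2 g\<^sup>k\<^sup>l (\<partial>\<^sub>i g\<^sub>j\<^sub>l + \<partial>\<^sub>j g\<^sub>i\<^sub>l - \<partial>\<^sub>l g\<^sub>i\<^sub>j)\<close>, as a bilinear map.\<close>

definition christoffel ::
    "(real ^ 'n \<Rightarrow> real ^ 'n ^ 'n) \<Rightarrow> real ^ 'n \<Rightarrow> real ^ 'n \<Rightarrow> real ^ 'n \<Rightarrow> real ^ 'n::finite" where
  "christoffel g x u v = matrix_inv (g x) *v
     (\<chi> l. (ip (frechet_derivative g (at x) u) v (axis l 1)
          + ip (frechet_derivative g (at x) v) u (axis l 1)
          - ip (frechet_derivative g (at x) (axis l 1)) u v) / 2)"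

text \<open>The Levi-Civita connection \<open>\<nabla>\<^sub>X Y\<close>.\<close>

definition levi_civita ::
    "(real ^ 'n \<Rightarrow> real ^ 'n ^ 'n) \<Rightarrow> (real ^ 'n \<Rightarrow> real ^ 'n) \<Rightarrow> (real ^ 'n \<Rightarrow> real ^ 'n)
       \<Rightarrow> real ^ 'n \<Rightarrow> real ^ 'n::finite" where
  "levi_civita g X Y x = diff_at Y x (X x) + christoffel g x (X x) (Y x)"

definition lie_bracket ::
    "(real ^ 'n \<Rightarrow> real ^ 'n) \<Rightarrow> (real ^ 'n \<Rightarrow> real ^ 'n) \<Rightarrow> real ^ 'n \<Rightarrow> real ^ 'n::finite" where
  "lie_bracket X Y x = diff_at Y x (X x) - diff_at X x (Y x)"

text \<open>\<open>R(X,Y)Z\<close> for vector fields, and for vectors at a point.\<close>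

definition curvature_field ::
    "(real ^ 'n \<Rightarrow> real ^ 'n ^ 'n) \<Rightarrow> (real ^ 'n \<Rightarrow> real ^ 'n) \<Rightarrow> (real ^ 'n \<Rightarrow> real ^ 'n)
       \<Rightarrow> (real ^ 'n \<Rightarrow> real ^ 'n) \<Rightarrow> real ^ 'n \<Rightarrow> real ^ 'n::finite" where
  "curvature_field g X Y Z x =
     levi_civita g X (levi_civita g Y Z) x - levi_civita g Y (levi_civita g X Z) x
       - levi_civita g (lie_bracket X Y) Z x"

definition curvature ::
    "(real ^ 'n \<Rightarrow> real ^ 'n ^ 'n) \<Rightarrow> real ^ 'n \<Rightarrow> real ^ 'n \<Rightarrow> real ^ 'n \<Rightarrow> real ^ 'n
       \<Rightarrow> real ^ 'n::finite" where
  "curvature g x u v w = curvature_field g (\<lambda>_. u) (\<lambda>_. v) (\<lambda>_. w) x"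

definition scalar_curvature :: "(real ^ 'n \<Rightarrow> real ^ 'n ^ 'n) \<Rightarrow> real ^ 'n::finite \<Rightarrow> real" where
  "scalar_curvature g x =
     frame_sum (g x) (\<lambda>u. frame_sum (g x) (\<lambda>v. ip (g x) (curvature g x u v v) u))"

text \<open>The connection induced on the pull-back of the tangent bundle: \<open>V\<close> is a vector field along
  \<open>F\<close>, \<open>X\<close> is tangent to the source.\<close>

definition pullback_connection ::
    "(real ^ 'n \<Rightarrow> real ^ 'n ^ 'n) \<Rightarrow> (real ^ 'm \<Rightarrow> real ^ 'n) \<Rightarrow> (real ^ 'm \<Rightarrow> real ^ 'm)
       \<Rightarrow> (real ^ 'm \<Rightarrow> real ^ 'n) \<Rightarrow> real ^ 'm::finite \<Rightarrow> real ^ 'n::finite" where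
  "pullback_connection h F X V x =
     diff_at V x (X x) + christoffel h (F x) (diff_at F x (X x)) (V x)"

text \<open>\<open>(\<nabla>\<^sup>2 V)(u,v)\<close> for a vector field \<open>V\<close> along \<open>F\<close>, and its trace, the rough Laplacian.\<close>

definition second_covariant_derivative ::
    "(real ^ 'm \<Rightarrow> real ^ 'm ^ 'm) \<Rightarrow> (real ^ 'n \<Rightarrow> real ^ 'n ^ 'n) \<Rightarrow> (real ^ 'm \<Rightarrow> real ^ 'n)
       \<Rightarrow> (real ^ 'm \<Rightarrow> real ^ 'n) \<Rightarrow> real ^ 'm \<Rightarrow> real ^ 'm \<Rightarrow> real ^ 'm::finite
       \<Rightarrow> real ^ 'n::finite" where
  "second_covariant_derivative g h F V x u v =
     pullback_connection h F (\<lambda>_. u) (pullback_connection h F (\<lambda>_. v) V) x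
       - pullback_connection h F (levi_civita g (\<lambda>_. u) (\<lambda>_. v)) V x"

definition rough_laplacian ::
    "(real ^ 'm \<Rightarrow> real ^ 'm ^ 'm) \<Rightarrow> (real ^ 'n \<Rightarrow> real ^ 'n ^ 'n) \<Rightarrow> (real ^ 'm \<Rightarrow> real ^ 'n)
       \<Rightarrow> (real ^ 'm \<Rightarrow> real ^ 'n) \<Rightarrow> real ^ 'm::finite \<Rightarrow> real ^ 'n::finite" where
  "rough_laplacian g h F V x = frame_sum (g x) (\<lambda>u. second_covariant_derivative g h F V x u u)"

text \<open>\<open>(\<nabla>dF)(u,v) = \<nabla>\<^sub>u (dF v) - dF (\<nabla>\<^sub>u v)\<close>, and its trace, the tension field.\<close>

definition nabla_d ::
    "(real ^ 'm \<Rightarrow> real ^ 'm ^ 'm) \<Rightarrow> (real ^ 'n \<Rightarrow> real ^ 'n ^ 'n) \<Rightarrow> (real ^ 'm \<Rightarrow> real ^ 'n)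
       \<Rightarrow> real ^ 'm \<Rightarrow> real ^ 'm \<Rightarrow> real ^ 'm::finite \<Rightarrow> real ^ 'n::finite" where
  "nabla_d g h F x u v =
     pullback_connection h F (\<lambda>_. u) (\<lambda>y. diff_at F y v) x
       - diff_at F x (levi_civita g (\<lambda>_. u) (\<lambda>_. v) x)"

definition tension_field ::
    "(real ^ 'm \<Rightarrow> real ^ 'm ^ 'm) \<Rightarrow> (real ^ 'n \<Rightarrow> real ^ 'n ^ 'n) \<Rightarrow> (real ^ 'm \<Rightarrow> real ^ 'n)
       \<Rightarrow> real ^ 'm::finite \<Rightarrow> real ^ 'n::finite" where
  "tension_field g h F x = frame_sum (g x) (\<lambda>u. nabla_d g h F x u u)"

definition bitension_field ::
    "(real ^ 'm \<Rightarrow> real ^ 'm ^ 'm) \<Rightarrow> (real ^ 'n \<Rightarrow> real ^ 'n ^ 'n) \<Rightarrow> (real ^ 'm \<Rightarrow> real ^ 'n)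
       \<Rightarrow> real ^ 'm::finite \<Rightarrow> real ^ 'n::finite" where
  "bitension_field g h F x =
     rough_laplacian g h F (tension_field g h F) x
       - frame_sum (g x)
           (\<lambda>u. curvature h (F x) (diff_at F x u) (tension_field g h F x) (diff_at F x u))"

text \<open>The component of \<open>w\<close> normal to the image of \<open>dF\<close>, for an isometric immersion \<open>F\<close>.\<close>

definition normal_part ::
    "(real ^ 'm \<Rightarrow> real ^ 'm ^ 'm) \<Rightarrow> (real ^ 'n \<Rightarrow> real ^ 'n ^ 'n) \<Rightarrow> (real ^ 'm \<Rightarrow> real ^ 'n)
       \<Rightarrow> real ^ 'm::finite \<Rightarrow> real ^ 'n \<Rightarrow> real ^ 'n::finite" where
  "normal_part g h F x w =
     w - frame_sum (g x) (\<lambda>u. ip (h (F x)) w (diff_at F x u) *\<^sub>R diff_at F x u)"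

text \<open>The second fundamental form as a normal-valued form. For a hypersurface, its norm and that
  of its trace are those of the scalar second fundamental form \<open>h (B(u,v), \<eta>)\<close>, whatever the
  choice of the local unit normal \<open>\<eta>\<close>.\<close>

definition second_fundamental_form ::
    "(real ^ 'm \<Rightarrow> real ^ 'm ^ 'm) \<Rightarrow> (real ^ 'n \<Rightarrow> real ^ 'n ^ 'n) \<Rightarrow> (real ^ 'm \<Rightarrow> real ^ 'n)
       \<Rightarrow> real ^ 'm \<Rightarrow> real ^ 'm \<Rightarrow> real ^ 'm::finite \<Rightarrow> real ^ 'n::finite" where
  "second_fundamental_form g h F x u v =
     normal_part g h F x (pullback_connection h F (\<lambda>_. u) (\<lambda>y. diff_at F y v) x)"

definition second_fundamental_form_norm_sq ::
    "(real ^ 'm \<Rightarrow> real ^ 'm ^ 'm) \<Rightarrow> (real ^ 'n \<Rightarrow> real ^ 'n ^ 'n) \<Rightarrow> (real ^ 'm \<Rightarrow> real ^ 'n::finite)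
       \<Rightarrow> real ^ 'm::finite \<Rightarrow> real" where
  "second_fundamental_form_norm_sq g h F x =
     frame_sum (g x) (\<lambda>u. frame_sum (g x) (\<lambda>v.
       ip (h (F x)) (second_fundamental_form g h F x u v) (second_fundamental_form g h F x u v)))"

definition mean_curvature_vector ::
    "(real ^ 'm \<Rightarrow> real ^ 'm ^ 'm) \<Rightarrow> (real ^ 'n \<Rightarrow> real ^ 'n ^ 'n) \<Rightarrow> (real ^ 'm \<Rightarrow> real ^ 'n)
       \<Rightarrow> real ^ 'm::finite \<Rightarrow> real ^ 'n::finite" where
  "mean_curvature_vector g h F x =
     (1 / real CARD('m)) *\<^sub>R frame_sum (g x) (\<lambda>u. second_fundamental_form g h F x u u)"

definition mean_curvature_length ::
    "(real ^ 'm \<Rightarrow> real ^ 'm ^ 'm) \<Rightarrow> (real ^ 'n \<Rightarrow> real ^ 'n ^ 'n) \<Rightarrow> (real ^ 'm \<Rightarrow> real ^ 'n::finite)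
       \<Rightarrow> real ^ 'm::finite \<Rightarrow> real" where
  "mean_curvature_length g h F x =
     sqrt (ip (h (F x)) (mean_curvature_vector g h F x) (mean_curvature_vector g h F x))"


section \<open>Generalized complex space forms and biharmonic submanifolds\<close>

definition R1 :: "real ^ 'n ^ 'n \<Rightarrow> real ^ 'n \<Rightarrow> real ^ 'n \<Rightarrow> real ^ 'n \<Rightarrow> real ^ 'n" where
  "R1 G u v w = ip G v w *\<^sub>R u - ip G u w *\<^sub>R v"

definition R2 ::
    "real ^ 'n ^ 'n \<Rightarrow> real ^ 'n ^ 'n \<Rightarrow> real ^ 'n \<Rightarrow> real ^ 'n \<Rightarrow> real ^ 'n \<Rightarrow> real ^ 'n" where
  "R2 G J u v w =
     ip G (J *v v) w *\<^sub>R (J *v u) - ip G (J *v u) w *\<^sub>R (J *v v)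
       + (2 * ip G (J *v v) u) *\<^sub>R (J *v w)"

definition generalized_complex_space_form ::
    "('a, 'n::finite, 'z) almost_hermitian_scheme \<Rightarrow> ('a \<Rightarrow> real) \<Rightarrow> ('a \<Rightarrow> real) \<Rightarrow> bool" where
  "generalized_complex_space_form N \<alpha> \<beta> \<longleftrightarrow>
     almost_hermitian_manifold N \<and> smooth_function N \<alpha> \<and> smooth_function N \<beta> \<and>
     (\<forall>d\<in>charts N. \<forall>q\<in>fst d. \<forall>u v w.
        curvature (metric N d) (snd d q) u v w =
        \<alpha> q *\<^sub>R R1 (metric N d (snd d q)) u v w
          + \<beta> q *\<^sub>R R2 (metric N d (snd d q)) (acs N d (snd d q)) u v w)"

text \<open>Vector fields along a map, and scalars built from a map, are given by their expressions in
  charts of the source and of the target. A statement about them at a point is understood to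
  hold in every pair of charts around the point and its image; by invariance this is the same as
  holding in one such pair.\<close>

definition charts_around ::
    "('a, 'm::finite, 'y) riemannian_scheme \<Rightarrow> ('b, 'n::finite, 'z) riemannian_scheme
       \<Rightarrow> ('a \<Rightarrow> 'b) \<Rightarrow> 'a \<Rightarrow> (('a, 'm) chart \<times> ('b, 'n) chart) set" where
  "charts_around M N \<psi> p = {(c, d). c \<in> charts M \<and> d \<in> charts N \<and> p \<in> fst c \<and> \<psi> p \<in> fst d}"

definition harmonic ::
    "('a, 'm::finite, 'y) riemannian_scheme \<Rightarrow> ('b, 'n::finite, 'z) riemannian_scheme
       \<Rightarrow> ('a \<Rightarrow> 'b) \<Rightarrow> bool" where
  "harmonic M N \<psi> \<longleftrightarrow> (\<forall>p\<in>topspace (mtop M). \<forall>(c, d)\<in>charts_around M N \<psi> p.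
     tension_field (metric M c) (metric N d) (local_rep c d \<psi>) (snd c p) = 0)"

definition biharmonic ::
    "('a, 'm::finite, 'y) riemannian_scheme \<Rightarrow> ('b, 'n::finite, 'z) riemannian_scheme
       \<Rightarrow> ('a \<Rightarrow> 'b) \<Rightarrow> bool" where
  "biharmonic M N \<psi> \<longleftrightarrow> (\<forall>p\<in>topspace (mtop M). \<forall>(c, d)\<in>charts_around M N \<psi> p.
     bitension_field (metric M c) (metric N d) (local_rep c d \<psi>) (snd c p) = 0)"

definition proper_biharmonic ::
    "('a, 'm::finite, 'y) riemannian_scheme \<Rightarrow> ('b, 'n::finite, 'z) riemannian_scheme
       \<Rightarrow> ('a \<Rightarrow> 'b) \<Rightarrow> bool" where
  "proper_biharmonic M N \<psi> \<longleftrightarrow> biharmonic M N \<psi> \<and> \<not> harmonic M N \<psi>"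

text \<open>The mean curvature vector has constant length \<open>\<bar>H\<bar>\<close>.\<close>

definition constant_mean_curvature ::
    "('a, 'm::finite, 'y) riemannian_scheme \<Rightarrow> ('b, 'n::finite, 'z) riemannian_scheme
       \<Rightarrow> ('a \<Rightarrow> 'b) \<Rightarrow> real \<Rightarrow> bool" where
  "constant_mean_curvature M N \<psi> H \<longleftrightarrow> (\<forall>p\<in>topspace (mtop M). \<forall>(c, d)\<in>charts_around M N \<psi> p.
     mean_curvature_length (metric M c) (metric N d) (local_rep c d \<psi>) (snd c p) = \<bar>H\<bar>)"

end

theory Submission
  imports Defs
begin

text \<open>
  All assertions are pointwise: at every point, in every pair of charts, the bitension field
  vanishes if and only if \<open>\<parallel>B\<parallel>\<^sup>2 = 3 (\<alpha> + \<beta>)\<close>, if and only if the formula for the scalar curvature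
  holds. So everything can be done for a local isometric immersion \<open>F\<close> between open sets with
  metrics \<open>g\<close> and \<open>h\<close>, and invariance under changes of charts is not an issue.

  Write \<open>m\<close> for the dimension of the hypersurface. As the mean curvature is a nonzero constant \<open>H\<close>,
  the tension field \<open>\<tau> = tr B\<close> is a normal field of constant length \<open>m \<bar>H\<bar>\<close>. It is used
  in place of a unit normal, which avoids the choice of an orientation and already shows that the
  immersion is not harmonic. It remains to compute the rough Laplacian of \<open>\<tau>\<close>, with \<open>E\<^sub>i\<close> an
  orthonormal frame.

  \<^item> Normal component: differentiating \<open>h (\<tau>, \<tau>) = const\<close> twice gives
    \<open>h (\<Delta>\<tau>, \<tau>) = - \<Sum> \<bar>\<nabla>\<^bsub>E\<^sub>i\<^esub> \<tau>\<bar>\<^sup>2\<close>, and since \<open>\<nabla>\<^sub>u \<tau>\<close> is tangent with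
    \<open>h (\<nabla>\<^sub>u \<tau>, dF w) = - h (B(u,w), \<tau>)\<close>, the right-hand side is \<open>- \<parallel>B\<parallel>\<^sup>2 \<bar>\<tau>\<bar>\<^sup>2\<close>.
  \<^item> Tangential component: \<open>h (\<nabla>\<^sup>2\<tau>(u,v), dF w)\<close> is symmetric in \<open>v\<close> and \<open>w\<close> because \<open>B\<close> is
    symmetric, and commuting \<open>u\<close> and \<open>v\<close> costs a curvature term. Hence \<open>h (\<Delta>\<tau>, dF w)\<close> is the trace of
    \<open>h (\<nabla>\<^sup>2\<tau>(w,\<cdot>), dF \<cdot>)\<close> plus a Ricci term. The trace is, up to sign, the derivative along \<open>w\<close> of
    the constant \<open>\<bar>\<tau>\<bar>\<^sup>2\<close>; the Ricci term vanishes because the Ricci tensor of \<open>\<alpha> R\<^sub>1 + \<beta> R\<^sub>2\<close> is a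
    multiple of the metric.

  Thus \<open>\<Delta>\<tau> = - \<parallel>B\<parallel>\<^sup>2 \<tau>\<close> (lemma \<open>rough_laplacian_tension\<close>). The curvature term of the bitension field
  is \<open>(m \<alpha> + 3 \<beta>) \<tau>\<close> by the form of the curvature tensor, so the bitension field is
  \<open>(m \<alpha> + 3 \<beta> - \<parallel>B\<parallel>\<^sup>2) \<tau>\<close> (lemma \<open>bitension_field_eq\<close>), with \<open>\<tau>\<close> nowhere zero. The trace of the
  Gauss equation gives \<open>Scal = (m - 1) (m \<alpha> + 3 \<beta>) + m\<^sup>2 H\<^sup>2 - \<parallel>B\<parallel>\<^sup>2\<close> (lemma
  \<open>scalar_curvature_eq\<close>), which for \<open>m = 3\<close> translates one condition into the other.

  The calculus needed in coordinates is that smooth functions are closed under the usual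
  operations, including inversion of matrices, and that second derivatives are symmetric.
\<close>

section \<open>Smooth functions\<close>

lemma frechet_derivative_eqI:
  "(f has_derivative f') (at x) \<Longrightarrow> frechet_derivative f (at x) = f'"
  by (metis frechet_derivative_at)

lemma frechet_derivative_cong_open:
  assumes "open S" "x \<in> S" "\<And>y. y \<in> S \<Longrightarrow> f y = g y"
  shows "frechet_derivative f (at x) = frechet_derivative g (at x)"
proof -
  have "(f has_derivative D) (at x) \<longleftrightarrow> (g has_derivative D) (at x)" for D
    using assms has_derivative_transform_within_open[of f D x UNIV S g]
      has_derivative_transform_within_open[of g D x UNIV S f] by auto
  then show ?thesis by (simp add: frechet_derivative_def)
qed

lemma Ck_on_cong:
  assumes "open S" "\<And>x. x \<in> S \<Longrightarrow> f x = g x" "Ck_on k S f"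
  shows "Ck_on k S g"
  using assms(2,3)
proof (induction k arbitrary: f g)
  case 0
  then show ?case by (simp cong: continuous_on_cong)
next
  case (Suc k)
  have "g differentiable at x" if "x \<in> S" for x
    using Suc.prems that assms(1) has_derivative_transform_within_open[of f _ x UNIV S g]
    by (fastforce simp: differentiable_def)
  moreover have "Ck_on k S (\<lambda>x. frechet_derivative g (at x) v)" for v
  proof (rule Suc.IH)
    show "frechet_derivative f (at x) v = frechet_derivative g (at x) v" if "x \<in> S" for x
      using frechet_derivative_cong_open[OF assms(1) that Suc.prems(1)] by simp
  qed (use Suc.prems in simp)
  ultimately show ?case by simp
qed

text \<open>The successor clause of \<open>Ck_on\<close> asks for differentiability and says nothing about the lower
  orders, so the inclusion of these classes in one another takes an induction.\<close>

lemma Ck_on_Suc_imp_Ck_on: "Ck_on (Suc k) S f \<Longrightarrow> Ck_on k S f"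
proof (induction k arbitrary: f)
  case 0
  then show ?case
    by (auto intro!: continuous_at_imp_continuous_on differentiable_imp_continuous_within)
next
  case (Suc k)
  have "Ck_on k S (\<lambda>x. frechet_derivative f (at x) v)" for v
    by (rule Suc.IH) (use Suc.prems in \<open>simp del: Ck_on.simps(1) add: Ck_on.simps(2)\<close>)
  then show ?case using Suc.prems by simp
qed

lemma Ck_on_const: "Ck_on k S (\<lambda>_. c)"
proof (induction k arbitrary: c)
  case (Suc k)
  show ?case using Suc.IH[of 0] by simp
qed simp

lemma Ck_on_add: "Ck_on k S f \<Longrightarrow> Ck_on k S g \<Longrightarrow> open S \<Longrightarrow> Ck_on k S (\<lambda>x. f x + g x)"
proof (induction k arbitrary: f g)
  case 0
  then show ?case by (auto intro: continuous_on_add)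
next
  case (Suc k)
  have D: "frechet_derivative (\<lambda>x. f x + g x) (at x) v
      = frechet_derivative f (at x) v + frechet_derivative g (at x) v" if "x \<in> S" for x v
    using Suc.prems that
    by (subst frechet_derivative_eqI[OF has_derivative_add[OF
          frechet_derivative_works[THEN iffD1] frechet_derivative_works[THEN iffD1]]]) auto
  have "Ck_on k S (\<lambda>x. frechet_derivative (\<lambda>x. f x + g x) (at x) v)" for v
    by (rule Ck_on_cong[OF _ _ Suc.IH[of "\<lambda>x. frechet_derivative f (at x) v"
          "\<lambda>x. frechet_derivative g (at x) v"]])
      (use Suc.prems D in \<open>auto\<close>)
  then show ?case using Suc.prems by simp
qed

lemma Ck_on_sum:
  "(\<And>i. i \<in> I \<Longrightarrow> Ck_on k S (f i)) \<Longrightarrow> open S \<Longrightarrow> Ck_on k S (\<lambda>x. \<Sum>i\<in>I. f i x)"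
  by (induction I rule: infinite_finite_induct) (auto simp: Ck_on_const intro!: Ck_on_add)

text \<open>By the Leibniz rule the derivative of a product is a sum of products of one order less, which
  is why the factors are generalized in the induction.\<close>

lemma (in bounded_bilinear) Ck_on:
  "Ck_on k S f \<Longrightarrow> Ck_on k S g \<Longrightarrow> open S \<Longrightarrow> Ck_on k S (\<lambda>x. prod (f x) (g x))"
proof (induction k arbitrary: f g)
  case 0
  then show ?case by (auto intro: continuous_on)
next
  case (Suc k)
  note D = FDERIV[OF frechet_derivative_works[THEN iffD1, of f]
      frechet_derivative_works[THEN iffD1, of g]]
  have "(\<lambda>x. prod (f x) (g x)) differentiable at x" if "x \<in> S" for x
    using D[of x UNIV] Suc.prems that by (auto simp: differentiable_def)
  moreover have "Ck_on k S (\<lambda>x. frechet_derivative (\<lambda>x. prod (f x) (g x)) (at x) v)" for v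
  proof (rule Ck_on_cong[OF \<open>open S\<close>])
    show "Ck_on k S (\<lambda>x. prod (f x) (frechet_derivative g (at x) v)
        + prod (frechet_derivative f (at x) v) (g x))"
    proof (rule Ck_on_add)
      have "Ck_on k S f" "Ck_on k S g" using Suc.prems Ck_on_Suc_imp_Ck_on by blast+
      with Suc.prems show "Ck_on k S (\<lambda>x. prod (f x) (frechet_derivative g (at x) v))"
        "Ck_on k S (\<lambda>x. prod (frechet_derivative f (at x) v) (g x))"
        by (simp_all add: Suc.IH)
    qed fact
    show "prod (f x) (frechet_derivative g (at x) v) + prod (frechet_derivative f (at x) v) (g x)
        = frechet_derivative (\<lambda>x. prod (f x) (g x)) (at x) v" if "x \<in> S" for x
      using Suc.prems that by (subst frechet_derivative_eqI[OF D]) auto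
  qed
  ultimately show ?case by simp
qed

lemma (in bounded_linear) Ck_on:
  "Ck_on k S g \<Longrightarrow> open S \<Longrightarrow> Ck_on k S (\<lambda>x. f (g x))"
proof (induction k arbitrary: g)
  case 0
  then show ?case by (auto intro: continuous_on)
next
  case (Suc k)
  note D = has_derivative[OF frechet_derivative_works[THEN iffD1, of g]]
  have "(\<lambda>x. f (g x)) differentiable at x" if "x \<in> S" for x
    using D[of "at x"] Suc.prems that by (auto simp: differentiable_def)
  moreover have "Ck_on k S (\<lambda>x. frechet_derivative (\<lambda>x. f (g x)) (at x) v)" for v
    by (rule Ck_on_cong[OF _ _ Suc.IH[of "\<lambda>x. frechet_derivative g (at x) v"]])
      (use Suc.prems in \<open>auto simp: frechet_derivative_eqI[OF D]\<close>)
  ultimately show ?case by simp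
qed

text \<open>The chain rule, with the inner derivative expanded in a basis: the outer derivative is then
  only taken in constant directions, where the induction hypothesis applies.\<close>

lemma Ck_on_compose:
  fixes F :: "'a::euclidean_space \<Rightarrow> 'b::euclidean_space"
  assumes "open S" "open T" "F ` S \<subseteq> T"
  shows "Ck_on k S F \<Longrightarrow> Ck_on k T f \<Longrightarrow> Ck_on k S (\<lambda>x. f (F x))"
proof (induction k arbitrary: f)
  case 0
  then show ?case
    using continuous_on_compose2[of T f S F] assms by auto
next
  case (Suc k)
  have D: "((\<lambda>x. f (F x)) has_derivative
      (\<lambda>v. frechet_derivative f (at (F x)) (frechet_derivative F (at x) v))) (at x)"
    if "x \<in> S" for x
    using diff_chain_at[of F "frechet_derivative F (at x)" x f "frechet_derivative f (at (F x))"]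
      Suc.prems that assms(3)
    by (auto simp: o_def frechet_derivative_works[symmetric])
  have "(\<lambda>x. f (F x)) differentiable at x" if "x \<in> S" for x
    using D[OF that] by (auto simp: differentiable_def)
  moreover have "Ck_on k S (\<lambda>x. frechet_derivative (\<lambda>x. f (F x)) (at x) v)" for v
  proof (rule Ck_on_cong[OF \<open>open S\<close>])
    show "Ck_on k S (\<lambda>x. \<Sum>e\<in>Basis. (frechet_derivative F (at x) v \<bullet> e)
        *\<^sub>R frechet_derivative f (at (F x)) e)"
    proof (rule Ck_on_sum[OF bounded_bilinear.Ck_on[OF bounded_bilinear_scaleR]])
      show "Ck_on k S (\<lambda>x. frechet_derivative F (at x) v \<bullet> e)" for e
        using Suc.prems \<open>open S\<close> by (simp add: bounded_linear.Ck_on[OF bounded_linear_inner_left])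
      show "Ck_on k S (\<lambda>x. frechet_derivative f (at (F x)) e)" for e
        using Suc.prems by (intro Suc.IH Ck_on_Suc_imp_Ck_on[of k S F]) auto
    qed (rule \<open>open S\<close>)+
    show "(\<Sum>e\<in>Basis. (frechet_derivative F (at x) v \<bullet> e) *\<^sub>R frechet_derivative f (at (F x)) e)
        = frechet_derivative (\<lambda>x. f (F x)) (at x) v" if "x \<in> S" for x
    proof -
      have "linear (frechet_derivative f (at (F x)))"
        using Suc.prems that assms(3) by (auto intro!: linear_frechet_derivative)
      then have "frechet_derivative f (at (F x)) (\<Sum>e\<in>Basis. (frechet_derivative F (at x) v \<bullet> e) *\<^sub>R e)
        = (\<Sum>e\<in>Basis. (frechet_derivative F (at x) v \<bullet> e) *\<^sub>R frechet_derivative f (at (F x)) e)"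
        by (simp add: linear_sum linear_scale)
      then show ?thesis
        by (simp add: frechet_derivative_eqI[OF D[OF that]] euclidean_representation)
    qed
  qed
  ultimately show ?case by simp
qed

lemma Ck_on_inverse:
  fixes f :: "'a::euclidean_space \<Rightarrow> real"
  assumes "open S" "\<And>x. x \<in> S \<Longrightarrow> f x \<noteq> 0"
  shows "Ck_on k S f \<Longrightarrow> Ck_on k S (\<lambda>x. inverse (f x))"
proof (induction k)
  case 0
  then show ?case using assms by (auto intro: continuous_on_inverse)
next
  case (Suc k)
  have D: "((\<lambda>x. inverse (f x)) has_derivative
      (\<lambda>v. - (inverse (f x) * frechet_derivative f (at x) v * inverse (f x)))) (at x)"
    if "x \<in> S" for x
  proof -
    have "(f has_derivative frechet_derivative f (at x)) (at x)"
      using Suc.prems that by (simp add: frechet_derivative_works[symmetric])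
    from Deriv.has_derivative_inverse[OF assms(2)[OF that] this] show ?thesis .
  qed
  have "(\<lambda>x. inverse (f x)) differentiable at x" if "x \<in> S" for x
    using D[OF that] by (auto simp: differentiable_def)
  moreover have "Ck_on k S (\<lambda>x. frechet_derivative (\<lambda>x. inverse (f x)) (at x) v)" for v
  proof (rule Ck_on_cong[OF \<open>open S\<close>])
    show "Ck_on k S (\<lambda>x. - (inverse (f x) * frechet_derivative f (at x) v * inverse (f x)))"
      using Suc Ck_on_Suc_imp_Ck_on[of k S f] \<open>open S\<close>
      by (simp add: bounded_bilinear.Ck_on[OF bounded_bilinear_mult]
          bounded_linear.Ck_on[OF bounded_linear_minus[OF bounded_linear_ident]])
  qed (simp add: frechet_derivative_eqI[OF D])
  ultimately show ?case by simp
qed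

lemma smooth_on_differentiable: "smooth_on S f \<Longrightarrow> x \<in> S \<Longrightarrow> f differentiable at x"
  unfolding smooth_on_def by (metis Ck_on.simps(2))

lemma smooth_on_has_derivative:
  "smooth_on S f \<Longrightarrow> x \<in> S \<Longrightarrow> (f has_derivative frechet_derivative f (at x)) (at x)"
  using smooth_on_differentiable frechet_derivative_works by blast

lemma smooth_on_continuous_on: "smooth_on S f \<Longrightarrow> continuous_on S f"
  unfolding smooth_on_def by (metis Ck_on.simps(1))

lemma smooth_on_linear_derivative: "smooth_on S f \<Longrightarrow> x \<in> S \<Longrightarrow> linear (frechet_derivative f (at x))"
  by (simp add: linear_frechet_derivative smooth_on_differentiable)

lemma smooth_on_derivative:
  "smooth_on S f \<Longrightarrow> smooth_on S (\<lambda>x. frechet_derivative f (at x) v)"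
  unfolding smooth_on_def by (metis Ck_on.simps(2))

lemma smooth_on_cong:
  "smooth_on S f \<Longrightarrow> open S \<Longrightarrow> (\<And>x. x \<in> S \<Longrightarrow> f x = g x) \<Longrightarrow> smooth_on S g"
  unfolding smooth_on_def using Ck_on_cong by blast

lemma smooth_on_const: "smooth_on S (\<lambda>_. c)"
  unfolding smooth_on_def by (simp add: Ck_on_const)

lemma smooth_on_subset: "smooth_on T f \<Longrightarrow> S \<subseteq> T \<Longrightarrow> smooth_on S f"
proof -
  have "Ck_on k T f \<Longrightarrow> S \<subseteq> T \<Longrightarrow> Ck_on k S f" for k
    by (induction k arbitrary: f) (auto intro: continuous_on_subset)
  then show "smooth_on T f \<Longrightarrow> S \<subseteq> T \<Longrightarrow> smooth_on S f" by (simp add: smooth_on_def)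
qed

lemma smooth_on_id: "smooth_on S (\<lambda>x. x)"
proof -
  have "Ck_on k S (\<lambda>x. x)" for k by (cases k) (auto simp: Ck_on_const)
  then show ?thesis by (simp add: smooth_on_def)
qed

lemma smooth_on_add:
  "smooth_on S f \<Longrightarrow> smooth_on S g \<Longrightarrow> open S \<Longrightarrow> smooth_on S (\<lambda>x. f x + g x)"
  unfolding smooth_on_def by (simp add: Ck_on_add)

lemma smooth_on_sum:
  "(\<And>i. i \<in> I \<Longrightarrow> smooth_on S (f i)) \<Longrightarrow> open S \<Longrightarrow> smooth_on S (\<lambda>x. \<Sum>i\<in>I. f i x)"
  unfolding smooth_on_def by (simp add: Ck_on_sum)

lemma smooth_on_bilinear:
  "bounded_bilinear B \<Longrightarrow> smooth_on S f \<Longrightarrow> smooth_on S g \<Longrightarrow> open S \<Longrightarrow> smooth_on S (\<lambda>x. B (f x) (g x))"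
  unfolding smooth_on_def using bounded_bilinear.Ck_on by blast

lemma smooth_on_linear:
  "bounded_linear L \<Longrightarrow> smooth_on S f \<Longrightarrow> open S \<Longrightarrow> smooth_on S (\<lambda>x. L (f x))"
  unfolding smooth_on_def using bounded_linear.Ck_on by blast

lemma smooth_on_scaleR:
  "smooth_on S f \<Longrightarrow> smooth_on S g \<Longrightarrow> open S \<Longrightarrow> smooth_on S (\<lambda>x. f x *\<^sub>R g x)"
  by (rule smooth_on_bilinear[OF bounded_bilinear_scaleR])

lemma smooth_on_mult:
  fixes f g :: "'a::euclidean_space \<Rightarrow> real"
  shows "smooth_on S f \<Longrightarrow> smooth_on S g \<Longrightarrow> open S \<Longrightarrow> smooth_on S (\<lambda>x. f x * g x)"
  by (rule smooth_on_bilinear[OF bounded_bilinear_mult])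

lemma smooth_on_uminus: "smooth_on S f \<Longrightarrow> open S \<Longrightarrow> smooth_on S (\<lambda>x. - f x)"
  by (rule smooth_on_linear[OF bounded_linear_minus[OF bounded_linear_ident]])

lemma smooth_on_diff:
  "smooth_on S f \<Longrightarrow> smooth_on S g \<Longrightarrow> open S \<Longrightarrow> smooth_on S (\<lambda>x. f x - g x)"
  using smooth_on_add[of S f "\<lambda>x. - g x"] smooth_on_uminus[of S g] by simp

lemma smooth_on_prod:
  fixes f :: "'i \<Rightarrow> 'a::euclidean_space \<Rightarrow> real"
  shows "(\<And>i. i \<in> I \<Longrightarrow> smooth_on S (f i)) \<Longrightarrow> open S \<Longrightarrow> smooth_on S (\<lambda>x. \<Prod>i\<in>I. f i x)"
  by (induction I rule: infinite_finite_induct) (auto simp: smooth_on_const intro!: smooth_on_mult)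

lemma smooth_on_divide:
  fixes f g :: "'a::euclidean_space \<Rightarrow> real"
  assumes "smooth_on S f" "smooth_on S g" "open S" "\<And>x. x \<in> S \<Longrightarrow> g x \<noteq> 0"
  shows "smooth_on S (\<lambda>x. f x / g x)"
proof -
  have "smooth_on S (\<lambda>x. inverse (g x))"
    using assms unfolding smooth_on_def by (simp add: Ck_on_inverse)
  then show ?thesis using smooth_on_mult[of S f "\<lambda>x. inverse (g x)"] assms
    by (simp add: divide_inverse)
qed

lemma smooth_on_compose:
  fixes F :: "'a::euclidean_space \<Rightarrow> 'b::euclidean_space"
  shows "smooth_on T f \<Longrightarrow> smooth_on S F \<Longrightarrow> F ` S \<subseteq> T \<Longrightarrow> open S \<Longrightarrow> open T
    \<Longrightarrow> smooth_on S (\<lambda>x. f (F x))"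
  unfolding smooth_on_def by (simp add: Ck_on_compose)

lemma smooth_on_component:
  "smooth_on S f \<Longrightarrow> open S \<Longrightarrow> smooth_on S (\<lambda>x. f x $ i)"
  by (rule smooth_on_linear[OF bounded_linear_vec_nth])

lemma smooth_on_vec_lambda:
  fixes f :: "'n::finite \<Rightarrow> 'a::euclidean_space \<Rightarrow> real"
  assumes "\<And>i. smooth_on S (f i)" "open S"
  shows "smooth_on S (\<lambda>x. \<chi> i. f i x)"
proof -
  have "(\<lambda>x. \<chi> i. f i x) = (\<lambda>x. \<Sum>i\<in>UNIV. f i x *\<^sub>R axis i 1)"
    by (auto simp: vec_eq_iff axis_def if_distrib cong: if_cong)
  then show ?thesis
    using assms by (auto intro!: smooth_on_sum smooth_on_scaleR smooth_on_const)
qed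

lemma smooth_on_det:
  fixes A :: "'a::euclidean_space \<Rightarrow> real ^ 'n::finite ^ 'n"
  assumes "\<And>i j. smooth_on S (\<lambda>x. A x $ i $ j)" "open S"
  shows "smooth_on S (\<lambda>x. det (A x))"
  unfolding det_def using assms
  by (intro smooth_on_sum smooth_on_mult smooth_on_prod smooth_on_const) auto

lemma matrix_inv_solves:
  fixes A :: "real ^ 'n::finite ^ 'n"
  assumes "invertible A"
  shows "A *v (matrix_inv A *v w) = w"
proof -
  have "A ** matrix_inv A = mat 1"
    using assms someI_ex[of "\<lambda>B. A ** B = mat 1 \<and> B ** A = mat 1"]
    by (auto simp: invertible_def matrix_inv_def)
  then show ?thesis by (simp add: matrix_vector_mul_assoc)
qed

text \<open>By Cramer's rule the entries are quotients of determinants.\<close>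

lemma smooth_on_matrix_inv:
  fixes A :: "'a::euclidean_space \<Rightarrow> real ^ 'n::finite ^ 'n"
  assumes A: "smooth_on S A" and "open S" and inv: "\<And>x. x \<in> S \<Longrightarrow> invertible (A x)"
  shows "smooth_on S (\<lambda>x. matrix_inv (A x) *v w)"
proof (rule smooth_on_cong[OF _ \<open>open S\<close>])
  let ?D = "\<lambda>x k. \<chi> i j. if j = k then w $ i else A x $ i $ j"
  have A': "smooth_on S (\<lambda>x. A x $ i $ j)" for i j
    by (intro smooth_on_component A assms)
  then have "smooth_on S (\<lambda>x. if j = k then w $ i else A x $ i $ j)" for i j k
    by (cases "j = k") (auto simp: smooth_on_const)
  with A' show "smooth_on S (\<lambda>x. \<chi> k. det (?D x k) / det (A x))"
    using inv \<open>open S\<close>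
    by (intro smooth_on_vec_lambda smooth_on_divide smooth_on_det)
       (auto simp: smooth_on_const invertible_det_nz)
  show "(\<chi> k. det (?D x k) / det (A x)) = matrix_inv (A x) *v w" if "x \<in> S" for x
  proof -
    have "det (A x) \<noteq> 0" using inv[OF that] by (simp add: invertible_det_nz)
    moreover have "A x *v (matrix_inv (A x) *v w) = w"
      by (rule matrix_inv_solves[OF inv[OF that]])
    ultimately show ?thesis by (rule cramer[THEN iffD1, symmetric])
  qed
qed

subsection \<open>Families of linear maps\<close>

text \<open>Christoffel symbols, differentials, metrics and covariant derivatives are all smooth families
  \<open>f y\<close> of linear maps, applied to vector fields. Expanding the field in a basis reduces everything
  about \<open>f y (a y)\<close> to constant fields.\<close>

lemma linear_family_expansion:
  fixes a :: "'b::euclidean_space"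
  assumes "linear f"
  shows "f a = (\<Sum>e\<in>Basis. (a \<bullet> e) *\<^sub>R f e)"
proof -
  have "f (\<Sum>e\<in>Basis. (a \<bullet> e) *\<^sub>R e) = (\<Sum>e\<in>Basis. (a \<bullet> e) *\<^sub>R f e)"
    using assms by (simp add: linear_sum linear_scale)
  then show ?thesis by (simp add: euclidean_representation)
qed

lemma smooth_on_linear_family:
  fixes f :: "'a::euclidean_space \<Rightarrow> 'b::euclidean_space \<Rightarrow> 'c::real_normed_vector"
  assumes "open S" and "\<And>b. smooth_on S (\<lambda>y. f y b)" and "smooth_on S a"
    and "\<And>y. y \<in> S \<Longrightarrow> linear (f y)"
  shows "smooth_on S (\<lambda>y. f y (a y))"
proof (rule smooth_on_cong[OF _ \<open>open S\<close>])
  show "smooth_on S (\<lambda>y. \<Sum>e\<in>Basis. (a y \<bullet> e) *\<^sub>R f y e)"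
    using assms by (intro smooth_on_sum smooth_on_scaleR smooth_on_linear[OF bounded_linear_inner_left])
qed (use assms(4) linear_family_expansion in \<open>metis\<close>)

text \<open>The Leibniz rule for the pairing of a family of linear maps with a vector field.\<close>

lemma derivative_linear_family:
  fixes f :: "'a::euclidean_space \<Rightarrow> 'b::euclidean_space \<Rightarrow> 'c::real_normed_vector"
  assumes "open S" "x \<in> S" and sm: "\<And>b. smooth_on S (\<lambda>y. f y b)" and a: "smooth_on S a"
    and lin: "\<And>y. y \<in> S \<Longrightarrow> linear (f y)"
  shows "frechet_derivative (\<lambda>y. f y (a y)) (at x) u
    = frechet_derivative (\<lambda>y. f y (a x)) (at x) u + f x (frechet_derivative a (at x) u)"
proof -
  let ?D = "\<lambda>b. frechet_derivative (\<lambda>y. f y b) (at x)"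
  note D = smooth_on_has_derivative[OF sm \<open>x \<in> S\<close>]
  have "((\<lambda>y. \<Sum>e\<in>Basis. (a y \<bullet> e) *\<^sub>R f y e) has_derivative
     (\<lambda>u. \<Sum>e\<in>Basis. (a x \<bullet> e) *\<^sub>R ?D e u + (frechet_derivative a (at x) u \<bullet> e) *\<^sub>R f x e)) (at x)"
    by (intro has_derivative_sum has_derivative_scaleR D
        bounded_linear.has_derivative[OF bounded_linear_inner_left]
        smooth_on_has_derivative[OF a \<open>x \<in> S\<close>])
  then have 1: "frechet_derivative (\<lambda>y. \<Sum>e\<in>Basis. (a y \<bullet> e) *\<^sub>R f y e) (at x) u
     = (\<Sum>e\<in>Basis. (a x \<bullet> e) *\<^sub>R ?D e u + (frechet_derivative a (at x) u \<bullet> e) *\<^sub>R f x e)"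
    by (simp add: frechet_derivative_eqI)
  have "((\<lambda>y. \<Sum>e\<in>Basis. (a x \<bullet> e) *\<^sub>R f y e) has_derivative
     (\<lambda>u. \<Sum>e\<in>Basis. (a x \<bullet> e) *\<^sub>R ?D e u)) (at x)"
    by (intro has_derivative_sum has_derivative_scaleR_right D)
  then have 2: "frechet_derivative (\<lambda>y. \<Sum>e\<in>Basis. (a x \<bullet> e) *\<^sub>R f y e) (at x) u
     = (\<Sum>e\<in>Basis. (a x \<bullet> e) *\<^sub>R ?D e u)"
    by (simp add: frechet_derivative_eqI)
  have "frechet_derivative (\<lambda>y. f y (a y)) (at x)
      = frechet_derivative (\<lambda>y. \<Sum>e\<in>Basis. (a y \<bullet> e) *\<^sub>R f y e) (at x)"
    "frechet_derivative (\<lambda>y. f y (a x)) (at x)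
      = frechet_derivative (\<lambda>y. \<Sum>e\<in>Basis. (a x \<bullet> e) *\<^sub>R f y e) (at x)"
    by (intro frechet_derivative_cong_open[OF \<open>open S\<close> \<open>x \<in> S\<close>] linear_family_expansion lin; assumption)+
  moreover have "f x (frechet_derivative a (at x) u)
      = (\<Sum>e\<in>Basis. (frechet_derivative a (at x) u \<bullet> e) *\<^sub>R f x e)"
    by (intro linear_family_expansion lin \<open>x \<in> S\<close>)
  ultimately show ?thesis using 1 2 by (simp add: sum.distrib)
qed

lemma linear_derivative_of_family:
  fixes f :: "'a::euclidean_space \<Rightarrow> 'b::euclidean_space \<Rightarrow> 'c::real_normed_vector"
  assumes "open S" "x \<in> S" and sm: "\<And>b. smooth_on S (\<lambda>y. f y b)"
    and lin: "\<And>y. y \<in> S \<Longrightarrow> linear (f y)"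
  shows "linear (\<lambda>b. frechet_derivative (\<lambda>y. f y b) (at x) u)"
proof -
  note D = smooth_on_has_derivative[OF sm \<open>x \<in> S\<close>]
  show ?thesis
  proof (rule linearI)
    fix b c :: 'b and r :: real
    have "frechet_derivative (\<lambda>y. f y (b + c)) (at x) = frechet_derivative (\<lambda>y. f y b + f y c) (at x)"
      "frechet_derivative (\<lambda>y. f y (r *\<^sub>R b)) (at x) = frechet_derivative (\<lambda>y. r *\<^sub>R f y b) (at x)"
      by (rule frechet_derivative_cong_open[OF assms(1,2)]; simp add: linear_add linear_scale lin)+
    then show "frechet_derivative (\<lambda>y. f y (b + c)) (at x) u
        = frechet_derivative (\<lambda>y. f y b) (at x) u + frechet_derivative (\<lambda>y. f y c) (at x) u"
      "frechet_derivative (\<lambda>y. f y (r *\<^sub>R b)) (at x) u = r *\<^sub>R frechet_derivative (\<lambda>y. f y b) (at x) u"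
      by (simp_all add: frechet_derivative_eqI[OF has_derivative_add[OF D D]]
          frechet_derivative_eqI[OF has_derivative_scaleR_right[OF D]])
  qed
qed

lemma derivative_compose:
  fixes F :: "'a::euclidean_space \<Rightarrow> 'b::euclidean_space"
  assumes "smooth_on T f" "smooth_on S F" "x \<in> S" "F x \<in> T"
  shows "frechet_derivative (\<lambda>y. f (F y)) (at x) u
    = frechet_derivative f (at (F x)) (frechet_derivative F (at x) u)"
  using diff_chain_at[OF smooth_on_has_derivative[OF assms(2,3)] smooth_on_has_derivative[OF assms(1,4)]]
  by (simp add: o_def frechet_derivative_eqI)

subsection \<open>Symmetry of second derivatives\<close>

text \<open>The second difference of \<open>f\<close> along \<open>u\<close> and \<open>v\<close> is symmetric in \<open>u\<close> and \<open>v\<close>. The mean value theorem,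
  applied once in each direction, turns it into a second derivative at a nearby point.\<close>

lemma second_difference_mean_value:
  fixes f :: "'a::euclidean_space \<Rightarrow> real"
  assumes f: "smooth_on S f" and "t > 0"
    and S: "\<And>a b. 0 \<le> a \<Longrightarrow> a \<le> t \<Longrightarrow> 0 \<le> b \<Longrightarrow> b \<le> t \<Longrightarrow> x + a *\<^sub>R u + b *\<^sub>R v \<in> S"
  shows "\<exists>a b. 0 < a \<and> a < t \<and> 0 < b \<and> b < t \<and>
     f (x + t *\<^sub>R u + t *\<^sub>R v) - f (x + t *\<^sub>R u) - f (x + t *\<^sub>R v) + f x
       = t * t * frechet_derivative (\<lambda>y. frechet_derivative f (at y) u) (at (x + a *\<^sub>R u + b *\<^sub>R v)) v"
proof -
  let ?Du = "\<lambda>y. frechet_derivative f (at y) u"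
  have along: "((\<lambda>s. q (y + s *\<^sub>R w)) has_real_derivative frechet_derivative q (at (y + s *\<^sub>R w)) w) (at s)"
    if "smooth_on S q" "y + s *\<^sub>R w \<in> S" for q :: "'a \<Rightarrow> real" and y w s
  proof -
    note Dq = smooth_on_has_derivative[OF that]
    have "((\<lambda>s. y + s *\<^sub>R w) has_derivative (\<lambda>r. r *\<^sub>R w)) (at s)"
      by (auto intro!: derivative_eq_intros)
    from diff_chain_at[OF this Dq]
    have "((\<lambda>s. q (y + s *\<^sub>R w)) has_derivative
        (\<lambda>r. frechet_derivative q (at (y + s *\<^sub>R w)) (r *\<^sub>R w))) (at s)"
      by (simp add: o_def)
    then show ?thesis
      using linear_scale[OF smooth_on_linear_derivative[OF that]]
      by (simp add: has_field_derivative_def mult_commute_abs)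
  qed
  let ?p = "\<lambda>s. f (x + t *\<^sub>R v + s *\<^sub>R u) - f (x + s *\<^sub>R u)"
  have "\<exists>a. 0 < a \<and> a < t \<and> ?p t - ?p 0
      = (t - 0) * (?Du (x + t *\<^sub>R v + a *\<^sub>R u) - ?Du (x + a *\<^sub>R u))"
  proof (intro MVT2 \<open>t > 0\<close> DERIV_diff along f)
    fix s assume "0 \<le> s" "s \<le> t"
    then show "x + t *\<^sub>R v + s *\<^sub>R u \<in> S" "x + s *\<^sub>R u \<in> S"
      using S[of s t] S[of s 0] \<open>t > 0\<close> by (simp_all add: algebra_simps)
  qed
  then obtain a where a: "0 < a" "a < t" and 1: "?p t - ?p 0
      = t * (?Du (x + t *\<^sub>R v + a *\<^sub>R u) - ?Du (x + a *\<^sub>R u))"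
    by auto
  have "\<exists>b. 0 < b \<and> b < t \<and> ?Du (x + a *\<^sub>R u + t *\<^sub>R v) - ?Du (x + a *\<^sub>R u + 0 *\<^sub>R v)
      = (t - 0) * frechet_derivative ?Du (at (x + a *\<^sub>R u + b *\<^sub>R v)) v"
    using S a by (intro MVT2 \<open>t > 0\<close> along smooth_on_derivative f) auto
  then obtain b where b: "0 < b" "b < t" and 2: "?Du (x + a *\<^sub>R u + t *\<^sub>R v) - ?Du (x + a *\<^sub>R u)
      = t * frechet_derivative ?Du (at (x + a *\<^sub>R u + b *\<^sub>R v)) v"
    by auto
  show ?thesis
    by (rule exI[of _ a], rule exI[of _ b])
       (use a b 1 2 in \<open>simp add: algebra_simps\<close>)
qed

lemma second_derivative_symmetric_real:
  fixes f :: "'a::euclidean_space \<Rightarrow> real"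
  assumes "open S" "x \<in> S" and f: "smooth_on S f"
  shows "frechet_derivative (\<lambda>y. frechet_derivative f (at y) u) (at x) v
       = frechet_derivative (\<lambda>y. frechet_derivative f (at y) v) (at x) u"
proof -
  let ?D = "\<lambda>u v y. frechet_derivative (\<lambda>y. frechet_derivative f (at y) u) (at y) v"
  have lim: "\<exists>e>0. \<forall>p. (0 < p \<and> p < e) \<longrightarrow>
      (\<exists>q. \<bar>q - ?D u v x\<bar> < d \<and> f (x + p *\<^sub>R u + p *\<^sub>R v) - f (x + p *\<^sub>R u) - f (x + p *\<^sub>R v) + f x = p * p * q)"
    if "d > 0" for u v d
  proof -
    \<comment> \<open>The point supplied by the mean value theorem tends to \<open>x\<close> with \<open>p\<close>.\<close>
    have "continuous_on S (?D u v)"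
      by (intro smooth_on_continuous_on smooth_on_derivative f)
    then have "isCont (?D u v) x"
      using assms continuous_on_eq_continuous_at by blast
    then obtain r where r: "r > 0" "\<And>y. dist y x < r \<Longrightarrow> dist (?D u v y) (?D u v x) < d"
      using \<open>d > 0\<close> unfolding continuous_at_eps_delta by blast
    obtain r' where r': "r' > 0" "ball x r' \<subseteq> S" using assms(1,2) open_contains_ball by blast
    \<comment> \<open>The summand 1 only serves to make the denominator positive.\<close>
    define e where "e = min r r' / (norm u + norm v + 1)"
    have pos: "norm u + norm v + 1 > 0"
      using norm_ge_zero[of u] norm_ge_zero[of v] by linarith
    have "e > 0" unfolding e_def using r(1) r'(1) pos by simp
    have near: "dist (x + a *\<^sub>R u + b *\<^sub>R v) x < min r r'" if "0 \<le> a" "0 \<le> b" "a \<le> p" "b \<le> p" "p < e" for a b p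
    proof -
      have "dist (x + a *\<^sub>R u + b *\<^sub>R v) x \<le> a * norm u + b * norm v"
        using norm_triangle_ineq[of "a *\<^sub>R u" "b *\<^sub>R v"] that by (simp add: dist_norm algebra_simps)
      also have "\<dots> \<le> p * norm u + p * norm v" using that by (intro add_mono mult_right_mono) auto
      also have "\<dots> \<le> p * (norm u + norm v + 1)" using that by (simp add: algebra_simps)
      also have "\<dots> < e * (norm u + norm v + 1)" using that pos by simp
      also have "\<dots> = min r r'" using pos by (simp add: e_def)
      finally show ?thesis .
    qed
    show ?thesis
    proof (rule exI[of _ e], intro conjI allI impI)
      show "e > 0" by fact
      fix p assume p: "0 < p \<and> p < e"
      have "x + a *\<^sub>R u + b *\<^sub>R v \<in> S" if "0 \<le> a" "a \<le> p" "0 \<le> b" "b \<le> p" for a b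
        using near[of a b p] that p r'(2) by (auto simp: dist_commute subset_eq)
      with p have "\<exists>a b. 0 < a \<and> a < p \<and> 0 < b \<and> b < p \<and>
          f (x + p *\<^sub>R u + p *\<^sub>R v) - f (x + p *\<^sub>R u) - f (x + p *\<^sub>R v) + f x
            = p * p * ?D u v (x + a *\<^sub>R u + b *\<^sub>R v)"
        by (intro second_difference_mean_value[OF f]) auto
      then obtain a b where ab: "0 < a" "a < p" "0 < b" "b < p" and
        eq: "f (x + p *\<^sub>R u + p *\<^sub>R v) - f (x + p *\<^sub>R u) - f (x + p *\<^sub>R v) + f x
         = p * p * ?D u v (x + a *\<^sub>R u + b *\<^sub>R v)" by blast
      have "\<bar>?D u v (x + a *\<^sub>R u + b *\<^sub>R v) - ?D u v x\<bar> < d"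
        using r(2)[of "x + a *\<^sub>R u + b *\<^sub>R v"] near[of a b p] ab p by (simp add: dist_real_def)
      with eq show "\<exists>q. \<bar>q - ?D u v x\<bar> < d \<and>
         f (x + p *\<^sub>R u + p *\<^sub>R v) - f (x + p *\<^sub>R u) - f (x + p *\<^sub>R v) + f x = p * p * q" by blast
    qed
  qed
  have "\<bar>?D u v x - ?D v u x\<bar> < d" if d: "d > 0" for d
  proof -
    obtain e1 where e1: "e1 > 0" "\<And>p. 0 < p \<Longrightarrow> p < e1 \<Longrightarrow> \<exists>q. \<bar>q - ?D u v x\<bar> < d/2
       \<and> f (x + p *\<^sub>R u + p *\<^sub>R v) - f (x + p *\<^sub>R u) - f (x + p *\<^sub>R v) + f x = p * p * q"
      using lim[OF half_gt_zero[OF d], of u v] by blast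
    obtain e2 where e2: "e2 > 0" "\<And>p. 0 < p \<Longrightarrow> p < e2 \<Longrightarrow> \<exists>q. \<bar>q - ?D v u x\<bar> < d/2
       \<and> f (x + p *\<^sub>R v + p *\<^sub>R u) - f (x + p *\<^sub>R v) - f (x + p *\<^sub>R u) + f x = p * p * q"
      using lim[OF half_gt_zero[OF d], of v u] by blast
    define p where "p = min e1 e2 / 2"
    have p: "p > 0" "p < e1" "p < e2" using e1(1) e2(1) by (auto simp: p_def)
    obtain q q' where q: "\<bar>q - ?D u v x\<bar> < d/2" "\<bar>q' - ?D v u x\<bar> < d/2"
      and "f (x + p *\<^sub>R u + p *\<^sub>R v) - f (x + p *\<^sub>R u) - f (x + p *\<^sub>R v) + f x = p * p * q"
      and "f (x + p *\<^sub>R v + p *\<^sub>R u) - f (x + p *\<^sub>R v) - f (x + p *\<^sub>R u) + f x = p * p * q'"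
      using e1(2)[of p] e2(2)[of p] p by blast
    then have "p * p * q = p * p * q'" by (simp add: algebra_simps)
    then have "q = q'" using p by simp
    then show ?thesis using q by linarith
  qed
  then have "\<not> (0 < \<bar>?D u v x - ?D v u x\<bar>)" by blast
  then show ?thesis by simp
qed

lemma second_derivative_symmetric:
  fixes f :: "'a::euclidean_space \<Rightarrow> 'b::euclidean_space"
  assumes "open S" "x \<in> S" and f: "smooth_on S f"
  shows "frechet_derivative (\<lambda>y. frechet_derivative f (at y) u) (at x) v
       = frechet_derivative (\<lambda>y. frechet_derivative f (at y) v) (at x) u"
proof (rule euclidean_eqI)
  fix e :: 'b assume "e \<in> Basis"
  have comp: "frechet_derivative q (at y) w \<bullet> e = frechet_derivative (\<lambda>y. q y \<bullet> e) (at y) w"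
    if "smooth_on S q" "y \<in> S" for q :: "'a \<Rightarrow> 'b" and y w
    using frechet_derivative_eqI[OF bounded_linear.has_derivative[OF bounded_linear_inner_left
          smooth_on_has_derivative[OF that]]] by simp
  have "frechet_derivative (\<lambda>y. frechet_derivative f (at y) u) (at x) v \<bullet> e
     = frechet_derivative (\<lambda>y. frechet_derivative (\<lambda>y. f y \<bullet> e) (at y) u) (at x) v" for u v
    unfolding comp[OF smooth_on_derivative[OF f] \<open>x \<in> S\<close>]
    by (rule fun_cong[OF frechet_derivative_cong_open[OF assms(1,2)]]) (simp add: comp[OF f])
  then show "frechet_derivative (\<lambda>y. frechet_derivative f (at y) u) (at x) v \<bullet> e
      = frechet_derivative (\<lambda>y. frechet_derivative f (at y) v) (at x) u \<bullet> e"
    using second_derivative_symmetric_real[OF assms(1,2) smooth_on_linear[OF bounded_linear_inner_left f \<open>open S\<close>]]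
    by simp
qed

section \<open>Inner products given by a matrix\<close>

lemma ip_add_left: "ip G (u + v) w = ip G u w + ip G v w"
  and ip_add_right: "ip G w (u + v) = ip G w u + ip G w v"
  and ip_scaleR_left: "ip G (c *\<^sub>R u) w = c * ip G u w"
  and ip_scaleR_right: "ip G w (c *\<^sub>R u) = c * ip G w u"
  and ip_zero_left: "ip G 0 w = 0"
  and ip_zero_right: "ip G w 0 = 0"
  for G :: "real ^ 'n::finite ^ 'n"
  by (simp_all add: ip_def inner_add_left inner_add_right matrix_vector_right_distrib
      matrix_vector_mult_scaleR)

lemma ip_diff_left: "ip G (u - v) w = ip G u w - ip G v w"
  and ip_diff_right: "ip G w (u - v) = ip G w u - ip G w v"
  and ip_minus_left: "ip G (- u) w = - ip G u w"
  and ip_minus_right: "ip G w (- u) = - ip G w u"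
  for G :: "real ^ 'n::finite ^ 'n"
  using ip_add_left[of G "u - v" v w] ip_add_right[of G w "u - v" v]
    ip_add_left[of G "- u" u w] ip_add_right[of G w "- u" u]
  by (simp_all add: ip_zero_left ip_zero_right)

lemma ip_sum_left: "ip G (\<Sum>i\<in>I. f i) w = (\<Sum>i\<in>I. ip G (f i) w)"
  and ip_sum_right: "ip G w (\<Sum>i\<in>I. f i) = (\<Sum>i\<in>I. ip G w (f i))"
  for G :: "real ^ 'n::finite ^ 'n"
  by (induction I rule: infinite_finite_induct)
     (auto simp: ip_zero_left ip_zero_right ip_add_left ip_add_right)

lemmas ip_simps = ip_add_left ip_add_right ip_scaleR_left ip_scaleR_right ip_zero_left ip_zero_right
  ip_diff_left ip_diff_right ip_minus_left ip_minus_right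

lemma linear_ip_left: "linear (\<lambda>u. ip G u v)"
  and linear_ip_right: "linear (\<lambda>v. ip G u v)"
  and linear_ip_matrix: "linear (\<lambda>G. ip G u v)"
  for G :: "real ^ 'n::finite ^ 'n"
  by (auto intro!: linearI simp: ip_simps)
     (simp_all add: ip_def matrix_vector_mult_add_rdistrib inner_add_right scaleR_matrix_vector_assoc[symmetric])

definition some_frame :: "real ^ 'n ^ 'n \<Rightarrow> 'n::finite \<Rightarrow> real ^ 'n" where
  "some_frame G = (SOME E. orthonormal_frame G E)"

lemma frame_sum_some_frame: "frame_sum G q = (\<Sum>i\<in>UNIV. q (some_frame G i))"
  by (simp add: frame_sum_def some_frame_def)

text \<open>The matrix of a Riemannian metric at a point.\<close>

locale inner_product_matrix =
  fixes G :: "real ^ 'n::finite ^ 'n"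
  assumes ip_commute: "ip G u v = ip G v u"
    and ip_pos: "u \<noteq> 0 \<Longrightarrow> ip G u u > 0"
begin

lemma ip_nondegenerate: "(\<And>w. ip G u w = 0) \<Longrightarrow> u = 0"
  using ip_pos[of u] by (metis less_irrefl)

lemma ip_cancel: "(\<And>w. ip G u w = ip G v w) \<Longrightarrow> u = v"
  using ip_nondegenerate[of "u - v"] by (simp add: ip_simps)

lemma invertible: "invertible G"
proof -
  have "u = 0" if "G *v u = 0" for u
    using ip_pos[of u] that by (auto simp: ip_def)
  then show ?thesis
    using matrix_left_invertible_ker[of G] invertible_left_inverse by blast
qed

lemma ip_matrix_inv: "ip G (matrix_inv G *v c) w = c \<bullet> w"
  using matrix_inv_solves[OF invertible, of c] by (subst ip_commute) (simp add: ip_def inner_commute)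

text \<open>The vectors of an orthonormal set \<open>B\<close> are independent, so if there are \<open>n\<close> of them, they
  span, and a vector is determined by its products with them.\<close>

lemma orthonormal_expansion_set:
  assumes "finite B" "card B = CARD('n)"
    and on: "\<And>u v. u \<in> B \<Longrightarrow> v \<in> B \<Longrightarrow> ip G u v = (if u = v then 1 else 0)"
  shows "w = (\<Sum>b\<in>B. ip G w b *\<^sub>R b)"
proof -
  have coeff: "ip G (\<Sum>b\<in>B. c b *\<^sub>R b) v = c v" if "v \<in> B" for c v
  proof -
    have "ip G (\<Sum>b\<in>B. c b *\<^sub>R b) v = (\<Sum>b\<in>B. if b = v then c b else 0)"
      unfolding ip_sum_left using that by (intro sum.cong) (auto simp: ip_simps on)
    then show ?thesis using that \<open>finite B\<close> by simp
  qed
  have "independent B"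
    unfolding independent_explicit using \<open>finite B\<close> coeff by (metis ip_zero_left)
  then have "span B = UNIV"
    using card_ge_dim_independent[of B UNIV] assms(2) by (auto simp: dim_UNIV)
  then obtain c where c: "w = (\<Sum>b\<in>B. c b *\<^sub>R b)"
    using span_finite[OF \<open>finite B\<close>] by (metis (no_types, lifting) UNIV_I imageE)
  have "(\<Sum>b\<in>B. ip G w b *\<^sub>R b) = (\<Sum>b\<in>B. c b *\<^sub>R b)"
    by (rule sum.cong) (simp_all add: c coeff)
  then show ?thesis using c by simp
qed

text \<open>Gram-Schmidt: as long as an orthonormal set does not span, the normalized orthogonal
  component of a vector outside its span extends it.\<close>

lemma orthonormal_set_exists:
  assumes "k \<le> CARD('n)"
  shows "\<exists>B. finite B \<and> card B = k \<and>
    (\<forall>u\<in>B. \<forall>v\<in>B. ip G u v = (if u = v then 1 else 0))"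
  using assms
proof (induction k)
  case 0
  show ?case by (rule exI[of _ "{}"]) simp
next
  case (Suc k)
  then obtain B where B: "finite B" "card B = k"
    and on: "\<And>u v. u \<in> B \<Longrightarrow> v \<in> B \<Longrightarrow> ip G u v = (if u = v then 1 else 0)"
    by (metis Suc_leD)
  have "dim (span B) < dim (UNIV :: (real ^ 'n) set)"
    using B Suc.prems dim_le_card'[OF B(1)] by (simp add: dim_UNIV)
  then obtain v where v: "v \<notin> span B" by (metis UNIV_eq_I less_irrefl)
  define p where "p = v - (\<Sum>b\<in>B. ip G v b *\<^sub>R b)"
  have "(\<Sum>b\<in>B. ip G v b *\<^sub>R b) \<in> span B"
    by (intro span_sum span_scale span_base)
  then have "p \<noteq> 0" using v by (auto simp: p_def)
  then have pos: "ip G p p > 0" by (rule ip_pos)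
  define e where "e = (1 / sqrt (ip G p p)) *\<^sub>R p"
  have "ip G p b = 0" if "b \<in> B" for b
  proof -
    have "ip G (\<Sum>b\<in>B. ip G v b *\<^sub>R b) b = (\<Sum>c\<in>B. if c = b then ip G v c else 0)"
      unfolding ip_sum_left using that by (intro sum.cong) (auto simp: ip_simps on)
    then show ?thesis using that B(1) by (simp add: p_def ip_simps)
  qed
  then have eb: "ip G e b = 0" "ip G b e = 0" if "b \<in> B" for b
    using that ip_commute[of b e] by (simp_all add: e_def ip_simps)
  have ee: "ip G e e = 1" using pos by (simp add: e_def ip_simps)
  have "e \<notin> B" using eb ee by force
  then show ?case
    using B on eb ee by (intro exI[of _ "insert e B"]) auto
qed

lemma orthonormal_frame_exists: "\<exists>E. orthonormal_frame G E"
proof -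
  obtain B where B: "finite B" "card B = CARD('n)"
    and on: "\<And>u v. u \<in> B \<Longrightarrow> v \<in> B \<Longrightarrow> ip G u v = (if u = v then 1 else 0)"
    using orthonormal_set_exists[of "CARD('n)"] by auto
  obtain E where E: "bij_betw E (UNIV :: 'n set) B"
    using finite_same_card_bij[OF finite_class.finite_UNIV B(1)] B(2) by metis
  then have "orthonormal_frame G E"
    unfolding orthonormal_frame_def
    by (auto simp: bij_betw_def on inj_eq)
  then show ?thesis by blast
qed

lemma orthonormal_some_frame: "orthonormal_frame G (some_frame G)"
  unfolding some_frame_def using orthonormal_frame_exists by (rule someI_ex)

lemma orthonormal_frame_expansion:
  assumes "orthonormal_frame G E"
  shows "w = (\<Sum>i\<in>UNIV. ip G w (E i) *\<^sub>R E i)"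
proof -
  have on: "ip G (E i) (E j) = (if i = j then 1 else 0)" for i j
    using assms by (simp add: orthonormal_frame_def)
  then have inj: "inj E" by (metis injI zero_neq_one)
  have "w = (\<Sum>b\<in>range E. ip G w b *\<^sub>R b)"
    by (rule orthonormal_expansion_set) (auto simp: card_image inj on inj_eq[OF inj])
  then show ?thesis by (simp add: sum.reindex[OF inj])
qed

text \<open>The contraction of a bilinear form with the inverse metric is its trace over any
  orthonormal frame. Unlike the frame, the left-hand side depends smoothly on the metric.\<close>

lemma trace_orthonormal_frame:
  fixes q :: "real ^ 'n \<Rightarrow> real ^ 'n \<Rightarrow> 'b::real_vector"
  assumes E: "orthonormal_frame G E"
    and lin: "\<And>u. linear (q u)" "\<And>v. linear (\<lambda>u. q u v)"
  shows "(\<Sum>j\<in>UNIV. q (axis j 1) (matrix_inv G *v axis j 1)) = (\<Sum>i\<in>UNIV. q (E i) (E i))"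
proof -
  have "q (axis j 1) (matrix_inv G *v axis j 1) = (\<Sum>i\<in>UNIV. (E i $ j) *\<^sub>R q (axis j 1) (E i))" for j
    by (subst orthonormal_frame_expansion[OF E, of "matrix_inv G *v axis j 1"])
       (simp add: linear_sum[OF lin(1)] linear_scale[OF lin(1)] ip_matrix_inv inner_axis' inner_axis inner_commute)
  then have "(\<Sum>j\<in>UNIV. q (axis j 1) (matrix_inv G *v axis j 1))
      = (\<Sum>j\<in>UNIV. \<Sum>i\<in>UNIV. (E i $ j) *\<^sub>R q (axis j 1) (E i))"
    by simp
  also have "\<dots> = (\<Sum>i\<in>UNIV. \<Sum>j\<in>UNIV. (E i $ j) *\<^sub>R q (axis j 1) (E i))"
    by (rule sum.swap)
  also have "\<dots> = (\<Sum>i\<in>UNIV. q (E i) (E i))"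
  proof (rule sum.cong)
    fix i
    have "q (\<Sum>j\<in>UNIV. (E i $ j) *\<^sub>R axis j 1) (E i) = (\<Sum>j\<in>UNIV. (E i $ j) *\<^sub>R q (axis j 1) (E i))"
      using lin(2)[of "E i"] by (simp add: linear_sum[OF lin(2)] linear_scale[OF lin(2)])
    moreover have "(\<Sum>j\<in>UNIV. (E i $ j) *\<^sub>R axis j 1) = E i"
      using basis_expansion[of "E i"] by (simp add: scalar_mult_eq_scaleR)
    ultimately show "(\<Sum>j\<in>UNIV. (E i $ j) *\<^sub>R q (axis j 1) (E i)) = q (E i) (E i)" by simp
  qed simp
  finally show ?thesis .
qed

end

text \<open>An orthonormal family \<open>f\<close> that is one short of a basis, completed by a multiple of a
  vector \<open>\<nu>\<close> orthogonal to it: the situation along a hypersurface with normal \<open>\<nu>\<close>.\<close>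

locale hyperplane_frame = inner_product_matrix G for G :: "real ^ 'n::finite ^ 'n" +
  fixes f :: "'m::finite \<Rightarrow> real ^ 'n" and \<nu> :: "real ^ 'n"
  assumes codim: "CARD('n) = CARD('m) + 1"
    and ortho: "ip G (f i) (f j) = (if i = j then 1 else 0)"
    and normal: "ip G (f i) \<nu> = 0"
    and \<nu>: "\<nu> \<noteq> 0"
begin

lemma normal': "ip G \<nu> (f i) = 0"
  using normal ip_commute by metis

lemma \<nu>_pos: "ip G \<nu> \<nu> > 0"
  using \<nu> by (rule ip_pos)

lemma expansion: "w = (\<Sum>i\<in>UNIV. ip G w (f i) *\<^sub>R f i) + (ip G w \<nu> / ip G \<nu> \<nu>) *\<^sub>R \<nu>"
proof -
  let ?e = "(1 / sqrt (ip G \<nu> \<nu>)) *\<^sub>R \<nu>"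
  have inj: "inj f" by (metis injI ortho zero_neq_one)
  have notin: "?e \<notin> range f"
  proof
    assume "?e \<in> range f"
    then obtain i where i: "?e = f i" by blast
    have "ip G (f i) (f i) = ip G ?e (f i)" by (simp add: i)
    also have "\<dots> = 0" by (simp add: ip_simps normal')
    finally show False by (simp add: ortho)
  qed
  have "w = (\<Sum>b\<in>insert ?e (range f). ip G w b *\<^sub>R b)"
    using \<nu>_pos notin
    by (intro orthonormal_expansion_set)
       (auto simp: card_image inj codim ortho inj_eq[OF inj] ip_simps normal normal' simp del: scaleR_eq_0_iff)
  also have "\<dots> = ip G w ?e *\<^sub>R ?e + (\<Sum>i\<in>UNIV. ip G w (f i) *\<^sub>R f i)"
    using notin by (simp add: sum.reindex[OF inj])
  also have "ip G w ?e *\<^sub>R ?e = (ip G w \<nu> / ip G \<nu> \<nu>) *\<^sub>R \<nu>"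
    using \<nu>_pos by (simp add: ip_simps)
  also have "\<dots> + (\<Sum>i\<in>UNIV. ip G w (f i) *\<^sub>R f i)
      = (\<Sum>i\<in>UNIV. ip G w (f i) *\<^sub>R f i) + (ip G w \<nu> / ip G \<nu> \<nu>) *\<^sub>R \<nu>"
    by (rule add.commute)
  finally show ?thesis .
qed

lemma parseval: "(\<Sum>i\<in>UNIV. ip G v (f i) * ip G w (f i)) = ip G v w - ip G v \<nu> * ip G w \<nu> / ip G \<nu> \<nu>"
  using arg_cong[OF expansion[of w], of "ip G v"]
  by (simp add: ip_simps ip_sum_right mult.commute)

lemma normal_multiple:
  assumes "\<And>i. ip G w (f i) = 0"
  shows "w = (ip G w \<nu> / ip G \<nu> \<nu>) *\<^sub>R \<nu>"
  using expansion[of w] assms by simp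

end

section \<open>The curvature tensor of a generalized complex space form\<close>

text \<open>The sums below are the traces of \<open>\<alpha> R1 + \<beta> R2\<close> over the tangent space of a hypersurface that enter
  the bitension field, the Codazzi equation and the scalar curvature.\<close>

locale hermitian_hyperplane = hyperplane_frame G f \<nu>
  for G :: "real ^ 'n::finite ^ 'n" and f :: "'m::finite \<Rightarrow> real ^ 'n" and \<nu> :: "real ^ 'n" +
  fixes J :: "real ^ 'n ^ 'n"
  assumes J_J: "J *v (J *v u) = - u"
    and J_isometry: "ip G (J *v u) (J *v v) = ip G u v"
begin

lemma J_skew: "ip G (J *v u) v = - ip G u (J *v v)"
  using J_isometry[of u "J *v v"] by (simp add: J_J ip_simps)

lemma J_orthogonal: "ip G (J *v u) u = 0"
  using J_skew[of u u] ip_commute[of u "J *v u"] by simp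

text \<open>\<open>R2\<close> contributes three times \<open>\<Sum> G (J \<nu>, f i) J (f i)\<close>. The rotated normal \<open>J \<nu>\<close> is tangent, so it
  equals its expansion in the \<open>f i\<close>, and this sum is \<open>J (J \<nu>) = - \<nu>\<close>.\<close>

lemma sum_R1_R2_normal:
  "(\<Sum>i\<in>UNIV. \<alpha> *\<^sub>R R1 G (f i) \<nu> (f i) + \<beta> *\<^sub>R R2 G J (f i) \<nu> (f i))
     = - ((real CARD('m) * \<alpha> + 3 * \<beta>) *\<^sub>R \<nu>)"
proof -
  have "R1 G (f i) \<nu> (f i) = - \<nu>" for i
    by (simp add: R1_def normal' ortho)
  then have 1: "(\<Sum>i\<in>UNIV. R1 G (f i) \<nu> (f i)) = - (real CARD('m) *\<^sub>R \<nu>)"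
    by (simp add: sum_constant_scaleR del: sum_constant)
  have "R2 G J (f i) \<nu> (f i) = 3 *\<^sub>R (ip G (J *v \<nu>) (f i) *\<^sub>R (J *v f i))" for i
    using scaleR_left_distrib[of 1 2 "ip G (J *v \<nu>) (f i) *\<^sub>R (J *v f i)"]
    by (simp add: R2_def J_orthogonal)
  then have "(\<Sum>i\<in>UNIV. R2 G J (f i) \<nu> (f i))
      = 3 *\<^sub>R (\<Sum>i\<in>UNIV. ip G (J *v \<nu>) (f i) *\<^sub>R (J *v f i))"
    unfolding scaleR_sum_right by simp
  also have "(\<Sum>i\<in>UNIV. ip G (J *v \<nu>) (f i) *\<^sub>R (J *v f i)) = - \<nu>"
  proof -
    have "J *v (\<Sum>i\<in>UNIV. ip G (J *v \<nu>) (f i) *\<^sub>R f i)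
        = (\<Sum>i\<in>UNIV. ip G (J *v \<nu>) (f i) *\<^sub>R (J *v f i))"
      by (simp add: linear_sum[OF matrix_vector_mul_linear] matrix_vector_mult_scaleR)
    moreover have "(\<Sum>i\<in>UNIV. ip G (J *v \<nu>) (f i) *\<^sub>R f i) = J *v \<nu>"
      using expansion[of "J *v \<nu>"] by (simp add: J_orthogonal)
    ultimately show ?thesis by (simp add: J_J)
  qed
  finally have 2: "(\<Sum>i\<in>UNIV. R2 G J (f i) \<nu> (f i)) = - (3 *\<^sub>R \<nu>)" by simp
  have "(\<Sum>i\<in>UNIV. \<alpha> *\<^sub>R R1 G (f i) \<nu> (f i) + \<beta> *\<^sub>R R2 G J (f i) \<nu> (f i))
     = \<alpha> *\<^sub>R (\<Sum>i\<in>UNIV. R1 G (f i) \<nu> (f i)) + \<beta> *\<^sub>R (\<Sum>i\<in>UNIV. R2 G J (f i) \<nu> (f i))"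
    unfolding scaleR_sum_right sum.distrib ..
  then show ?thesis unfolding 1 2 by (simp add: algebra_simps)
qed

text \<open>The tangential part of the Ricci tensor applied to the normal. \<open>R1\<close> contributes nothing, and since
  \<open>J \<nu>\<close> is tangent, Parseval reduces the contribution of \<open>R2\<close> to \<open>3 G (J W, J \<nu>) = 3 G (W, \<nu>) = 0\<close>.\<close>

lemma sum_R1_R2_tangent:
  assumes "ip G W \<nu> = 0"
  shows "(\<Sum>i\<in>UNIV. ip G (\<alpha> *\<^sub>R R1 G (f i) W \<nu> + \<beta> *\<^sub>R R2 G J (f i) W \<nu>) (f i)) = 0"
proof -
  have "ip G (\<alpha> *\<^sub>R R1 G (f i) W \<nu> + \<beta> *\<^sub>R R2 G J (f i) W \<nu>) (f i)
      = 3 * \<beta> * (ip G (J *v W) (f i) * ip G (J *v \<nu>) (f i))" for i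
    using assms J_skew[of "f i" \<nu>] ip_commute[of "f i" "J *v \<nu>"]
    by (simp add: R1_def R2_def ip_simps normal J_orthogonal algebra_simps)
  then have "(\<Sum>i\<in>UNIV. ip G (\<alpha> *\<^sub>R R1 G (f i) W \<nu> + \<beta> *\<^sub>R R2 G J (f i) W \<nu>) (f i))
      = 3 * \<beta> * (\<Sum>i\<in>UNIV. ip G (J *v W) (f i) * ip G (J *v \<nu>) (f i))"
    by (simp add: sum_distrib_left)
  then show ?thesis by (simp add: parseval J_isometry J_orthogonal assms)
qed

text \<open>\<open>R2\<close> contributes three times \<open>\<Sum> G (J (f j), f i)\<^sup>2\<close>. The tangential part of \<open>J (f j)\<close> has squared
  length \<open>1 - G (J (f j), \<nu>)\<^sup>2 / G (\<nu>, \<nu>)\<close>, and the subtracted terms add up to 1 because they are the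
  squared components of the tangent vector \<open>J \<nu>\<close> divided by its squared length.\<close>

lemma sum_R1_R2_scalar:
  "(\<Sum>i\<in>UNIV. \<Sum>j\<in>UNIV. ip G (\<alpha> *\<^sub>R R1 G (f i) (f j) (f j) + \<beta> *\<^sub>R R2 G J (f i) (f j) (f j)) (f i))
     = (real CARD('m) - 1) * (real CARD('m) * \<alpha> + 3 * \<beta>)"
proof -
  have summand: "ip G (\<alpha> *\<^sub>R R1 G (f i) (f j) (f j) + \<beta> *\<^sub>R R2 G J (f i) (f j) (f j)) (f i)
      = \<alpha> - (if i = j then \<alpha> else 0) + 3 * \<beta> * (ip G (J *v f j) (f i) * ip G (J *v f j) (f i))" for i j
    using J_skew[of "f i" "f j"] ip_commute[of "f i" "J *v f j"]
    by (simp add: R1_def R2_def ip_simps ortho J_orthogonal algebra_simps)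
  have "(\<Sum>i\<in>UNIV. ip G (J *v f j) (f i) * ip G (J *v f j) (f i))
      = 1 - ip G (J *v f j) \<nu> * ip G (J *v f j) \<nu> / ip G \<nu> \<nu>" for j
    by (simp add: parseval J_isometry ortho)
  moreover have "ip G (J *v f j) \<nu> * ip G (J *v f j) \<nu> = ip G (J *v \<nu>) (f j) * ip G (J *v \<nu>) (f j)" for j
    using J_skew[of "f j" \<nu>] ip_commute[of "f j" "J *v \<nu>"] by simp
  ultimately have "(\<Sum>j\<in>UNIV. \<Sum>i\<in>UNIV. ip G (J *v f j) (f i) * ip G (J *v f j) (f i))
      = real CARD('m) - (\<Sum>j\<in>UNIV. ip G (J *v \<nu>) (f j) * ip G (J *v \<nu>) (f j)) / ip G \<nu> \<nu>"
    by (simp add: sum_subtractf sum_divide_distrib)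
  also have "\<dots> = real CARD('m) - 1"
    using \<nu>_pos by (simp add: parseval J_isometry J_orthogonal)
  finally have "(\<Sum>i\<in>UNIV. \<Sum>j\<in>UNIV. ip G (J *v f j) (f i) * ip G (J *v f j) (f i)) = real CARD('m) - 1"
    by (subst sum.swap)
  moreover have "(\<Sum>i\<in>UNIV. \<Sum>j\<in>UNIV. ip G (\<alpha> *\<^sub>R R1 G (f i) (f j) (f j) + \<beta> *\<^sub>R R2 G J (f i) (f j) (f j)) (f i))
     = real CARD('m) * (real CARD('m) * \<alpha>) - real CARD('m) * \<alpha>
       + 3 * \<beta> * (\<Sum>i\<in>UNIV. \<Sum>j\<in>UNIV. ip G (J *v f j) (f i) * ip G (J *v f j) (f i))"
    by (simp add: summand sum.distrib sum_subtractf sum_distrib_left right_diff_distrib)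
  ultimately show ?thesis by (simp only:, simp add: algebra_simps)
qed

end

section \<open>The Levi-Civita connection in a chart\<close>

locale riemannian_patch =
  fixes T :: "(real ^ 'n::finite) set" and h :: "real ^ 'n \<Rightarrow> real ^ 'n ^ 'n"
  assumes open_T: "open T"
    and smooth_h: "smooth_on T h"
    and inner_h: "z \<in> T \<Longrightarrow> inner_product_matrix (h z)"
begin

lemma smooth_ip_const: "smooth_on T (\<lambda>z. ip (h z) a b)"
  by (rule smooth_on_linear[OF _ smooth_h open_T]) (simp add: linear_ip_matrix linear_conv_bounded_linear[symmetric])

text \<open>The derivative \<open>\<partial>\<^sub>u h\<close> of the metric appears in the Christoffel symbols as a matrix; this
  identifies its entries with derivatives of scalar functions.\<close>

lemma derivative_ip_const:
  assumes "z \<in> T"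
  shows "frechet_derivative (\<lambda>z. ip (h z) a b) (at z) u = ip (frechet_derivative h (at z) u) a b"
proof -
  have "bounded_linear (\<lambda>G :: real ^ 'n ^ 'n. ip G a b)"
    by (simp add: linear_ip_matrix linear_conv_bounded_linear[symmetric])
  from bounded_linear.has_derivative[OF this smooth_on_has_derivative[OF smooth_h assms]]
  show ?thesis by (simp add: frechet_derivative_eqI)
qed

lemma derivative_metric_commute:
  assumes "z \<in> T"
  shows "ip (frechet_derivative h (at z) u) a b = ip (frechet_derivative h (at z) u) b a"
proof -
  have "frechet_derivative (\<lambda>z. ip (h z) a b) (at z) = frechet_derivative (\<lambda>z. ip (h z) b a) (at z)"
    by (rule frechet_derivative_cong_open[OF open_T assms])
       (rule inner_product_matrix.ip_commute[OF inner_h])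
  then show ?thesis using derivative_ip_const[OF assms] by metis
qed

text \<open>The Christoffel symbols are defined through the inverse of the metric and the coordinate
  covectors. This is the form of the definition without either, from which symmetry, bilinearity and
  compatibility with the metric follow by comparing inner products.\<close>

lemma koszul:
  assumes z: "z \<in> T"
  shows "ip (h z) (christoffel h z u v) w = (ip (frechet_derivative h (at z) u) v w
    + ip (frechet_derivative h (at z) v) u w - ip (frechet_derivative h (at z) w) u v) / 2"
proof -
  interpret inner_product_matrix "h z" by (rule inner_h[OF z])
  let ?D = "frechet_derivative h (at z)"
  let ?K = "\<lambda>w. (ip (?D u) v w + ip (?D v) u w - ip (?D w) u v) / 2"
  have "linear ?D" by (rule smooth_on_linear_derivative[OF smooth_h z])
  then have "linear ?K"
    by (auto intro!: linearI simp: ip_simps linear_add linear_scale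
        linear_add[OF linear_ip_matrix] linear_scale[OF linear_ip_matrix] field_simps)
  then have "?K w = (\<Sum>l\<in>UNIV. w $ l * ?K (axis l 1))"
    using linear_family_expansion[of ?K w]
    by (simp add: Basis_vec_def sum.reindex inj_on_def axis_eq_axis UNION_singleton_eq_range
        inner_axis inner_commute)
  also have "\<dots> = (\<chi> l. ?K (axis l 1)) \<bullet> w"
    by (simp add: inner_vec_def mult.commute)
  also have "\<dots> = ip (h z) (christoffel h z u v) w"
    by (simp add: christoffel_def ip_matrix_inv)
  finally show ?thesis by simp
qed

lemma christoffel_commute:
  assumes z: "z \<in> T" shows "christoffel h z u v = christoffel h z v u"
  by (rule inner_product_matrix.ip_cancel[OF inner_h[OF z]])
     (simp add: koszul[OF z] derivative_metric_commute[OF z, of _ u v])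

lemma linear_christoffel_right:
  assumes z: "z \<in> T" shows "linear (christoffel h z u)"
proof -
  note D = smooth_on_linear_derivative[OF smooth_h z]
  show ?thesis
    by (rule linearI; rule inner_product_matrix.ip_cancel[OF inner_h[OF z]])
       (simp_all add: koszul[OF z] ip_simps linear_add[OF D] linear_scale[OF D]
        linear_add[OF linear_ip_matrix] linear_scale[OF linear_ip_matrix] field_simps)
qed

lemma linear_christoffel_left:
  assumes z: "z \<in> T" shows "linear (\<lambda>u. christoffel h z u v)"
proof -
  have "(\<lambda>u. christoffel h z u v) = christoffel h z v"
    by (rule ext) (rule christoffel_commute[OF z])
  then show ?thesis using linear_christoffel_right[OF z, of v] by simp
qed

lemma christoffel_metric:
  assumes z: "z \<in> T"
  shows "ip (frechet_derivative h (at z) u) v w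
    = ip (h z) (christoffel h z u v) w + ip (h z) v (christoffel h z u w)"
  by (simp add: inner_product_matrix.ip_commute[OF inner_h[OF z], of v] koszul[OF z]
      derivative_metric_commute[OF z, of u w v] derivative_metric_commute[OF z, of w u v]
      derivative_metric_commute[OF z, of v u w] field_simps)

lemma smooth_christoffel: "smooth_on T (\<lambda>z. christoffel h z u v)"
  unfolding christoffel_def
proof (rule smooth_on_linear_family[OF open_T, of "\<lambda>z b. matrix_inv (h z) *v b"])
  show "smooth_on T (\<lambda>z. matrix_inv (h z) *v b)" for b
    by (intro smooth_on_matrix_inv smooth_h open_T inner_product_matrix.invertible inner_h)
  have D: "smooth_on T (\<lambda>z. ip (frechet_derivative h (at z) u) a b)" for u a b
    by (rule smooth_on_linear[OF _ smooth_on_derivative[OF smooth_h] open_T])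
       (simp add: linear_ip_matrix linear_conv_bounded_linear[symmetric])
  show "smooth_on T (\<lambda>z. \<chi> l. (ip (frechet_derivative h (at z) u) v (axis l 1)
       + ip (frechet_derivative h (at z) v) u (axis l 1)
       - ip (frechet_derivative h (at z) (axis l 1)) u v) / 2)"
    by (intro smooth_on_vec_lambda smooth_on_divide smooth_on_add smooth_on_diff D open_T smooth_on_const)
       simp
qed (rule matrix_vector_mul_linear)

text \<open>The Lie bracket of constant fields vanishes.\<close>

lemma curvature_eq:
  assumes z: "z \<in> T"
  shows "curvature h z a b w
    = diff_at (\<lambda>y. christoffel h y b w) z a - diff_at (\<lambda>y. christoffel h y a w) z b
      + christoffel h z a (christoffel h z b w) - christoffel h z b (christoffel h z a w)"
proof -
  have "christoffel h z 0 w = 0"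
    using linear_christoffel_left[OF z] by (rule linear_0)
  then show ?thesis
    by (simp add: curvature_def curvature_field_def levi_civita_def[abs_def] lie_bracket_def)
qed

end

section \<open>Vector fields along a map\<close>

text \<open>With \<open>F\<close> the identity, fields along \<open>F\<close> are ordinary vector fields and \<open>nab\<close> is the Levi-Civita
  connection; the source of an isometric immersion is treated in this way.\<close>

locale patch_map = riemannian_patch T h
  for T :: "(real ^ 'n::finite) set" and h :: "real ^ 'n \<Rightarrow> real ^ 'n ^ 'n" +
  fixes S :: "(real ^ 'm::finite) set" and F :: "real ^ 'm \<Rightarrow> real ^ 'n"
  assumes open_S: "open S"
    and smooth_F: "smooth_on S F"
    and F_in: "x \<in> S \<Longrightarrow> F x \<in> T"
begin

abbreviation nab :: "real ^ 'm \<Rightarrow> (real ^ 'm \<Rightarrow> real ^ 'n) \<Rightarrow> real ^ 'm \<Rightarrow> real ^ 'n" where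
  "nab u V y \<equiv> pullback_connection h F (\<lambda>_. u) V y"

lemma F_image: "F ` S \<subseteq> T"
  using F_in by blast

lemma nab_eq: "nab u V y = diff_at V y u + christoffel h (F y) (diff_at F y u) (V y)"
  by (simp add: pullback_connection_def)

lemma pullback_connection_pointwise:
  "pullback_connection h F X V y = nab (X y) V y"
  by (simp add: pullback_connection_def)

lemma derivative_constant:
  assumes x: "x \<in> S" and f: "\<And>y. y \<in> S \<Longrightarrow> f y = c"
  shows "frechet_derivative f (at x) u = 0"
  using frechet_derivative_cong_open[OF open_S x, of f "\<lambda>_. c"] f by simp

lemma linear_dF: "x \<in> S \<Longrightarrow> linear (diff_at F x)"
  by (rule smooth_on_linear_derivative[OF smooth_F])

lemma smooth_dF: "smooth_on S (\<lambda>y. diff_at F y u)"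
  by (rule smooth_on_derivative[OF smooth_F])

lemma smooth_push: "smooth_on S p \<Longrightarrow> smooth_on S (\<lambda>y. diff_at F y (p y))"
  by (rule smooth_on_linear_family[OF open_S smooth_dF]) (auto intro: linear_dF)

lemma smooth_christoffel_along_const: "smooth_on S (\<lambda>y. christoffel h (F y) a b)"
  by (rule smooth_on_compose[OF smooth_christoffel smooth_F F_image open_S open_T])

lemma smooth_christoffel_along_right:
  assumes "smooth_on S W" shows "smooth_on S (\<lambda>y. christoffel h (F y) a (W y))"
  by (rule smooth_on_linear_family[OF open_S smooth_christoffel_along_const assms])
     (rule linear_christoffel_right[OF F_in])

lemma smooth_christoffel_along:
  assumes "smooth_on S V" "smooth_on S W"
  shows "smooth_on S (\<lambda>y. christoffel h (F y) (V y) (W y))"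
  by (rule smooth_on_linear_family[OF open_S smooth_christoffel_along_right[OF assms(2)] assms(1)])
     (rule linear_christoffel_left[OF F_in])

lemma derivative_christoffel_along:
  assumes x: "x \<in> S" and V: "smooth_on S V" and W: "smooth_on S W"
  shows "diff_at (\<lambda>y. christoffel h (F y) (V y) (W y)) x u
    = diff_at (\<lambda>z. christoffel h z (V x) (W x)) (F x) (diff_at F x u)
      + christoffel h (F x) (diff_at V x u) (W x) + christoffel h (F x) (V x) (diff_at W x u)"
proof -
  have "diff_at (\<lambda>y. christoffel h (F y) (V y) (W y)) x u
      = diff_at (\<lambda>y. christoffel h (F y) (V x) (W y)) x u + christoffel h (F x) (diff_at V x u) (W x)"
    by (rule derivative_linear_family[OF open_S x smooth_christoffel_along_right[OF W] V])
       (rule linear_christoffel_left[OF F_in])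
  also have "diff_at (\<lambda>y. christoffel h (F y) (V x) (W y)) x u
      = diff_at (\<lambda>y. christoffel h (F y) (V x) (W x)) x u + christoffel h (F x) (V x) (diff_at W x u)"
    by (rule derivative_linear_family[OF open_S x smooth_christoffel_along_const W])
       (rule linear_christoffel_right[OF F_in])
  also have "diff_at (\<lambda>y. christoffel h (F y) (V x) (W x)) x u
      = diff_at (\<lambda>z. christoffel h z (V x) (W x)) (F x) (diff_at F x u)"
    by (rule derivative_compose[OF smooth_christoffel smooth_F x F_in[OF x]])
  finally show ?thesis by simp
qed

lemma smooth_nab:
  assumes "smooth_on S V" shows "smooth_on S (\<lambda>y. nab u V y)"
  unfolding nab_eq
  by (intro smooth_on_add smooth_on_derivative assms smooth_christoffel_along smooth_dF open_S)

lemma linear_nab: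
  assumes x: "x \<in> S" and V: "smooth_on S V" shows "linear (\<lambda>u. nab u V x)"
  unfolding nab_eq
  by (intro linear_compose_add smooth_on_linear_derivative[OF V x]
      linear_compose[OF linear_dF[OF x] linear_christoffel_left[OF F_in[OF x]], unfolded o_def])

lemma linear_nab_nab:
  assumes x: "x \<in> S" and V: "smooth_on S V"
  shows "linear (\<lambda>v. nab u (\<lambda>y. nab v V y) x)"
  unfolding nab_eq[of u]
  by (intro linear_compose_add linear_derivative_of_family[OF open_S x smooth_nab[OF V] linear_nab[OF _ V]]
      linear_compose[OF linear_nab[OF x V] linear_christoffel_right[OF F_in[OF x]], unfolded o_def])

lemma smooth_ip_along:
  assumes "smooth_on S V" "smooth_on S W"
  shows "smooth_on S (\<lambda>y. ip (h (F y)) (V y) (W y))"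
proof -
  have "smooth_on S (\<lambda>y. ip (h (F y)) a b)" for a b
    by (rule smooth_on_compose[OF smooth_ip_const smooth_F F_image open_S open_T])
  then have "smooth_on S (\<lambda>y. ip (h (F y)) a (W y))" for a
    by (rule smooth_on_linear_family[OF open_S _ assms(2) linear_ip_right])
  then show ?thesis
    by (rule smooth_on_linear_family[OF open_S _ assms(1) linear_ip_left])
qed

text \<open>By the Leibniz rule; the derivative of the metric along \<open>F\<close>
  supplies the two Christoffel terms.\<close>

lemma nab_metric:
  assumes x: "x \<in> S" and V: "smooth_on S V" and W: "smooth_on S W"
  shows "frechet_derivative (\<lambda>y. ip (h (F y)) (V y) (W y)) (at x) u
    = ip (h (F x)) (nab u V x) (W x) + ip (h (F x)) (V x) (nab u W x)"
proof -
  have sm: "smooth_on S (\<lambda>y. ip (h (F y)) a (W y))" "smooth_on S (\<lambda>y. ip (h (F y)) a b)" for a b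
    by (intro smooth_ip_along smooth_on_const W)+
  have "frechet_derivative (\<lambda>y. ip (h (F y)) (V y) (W y)) (at x) u
     = frechet_derivative (\<lambda>y. ip (h (F y)) (V x) (W y)) (at x) u + ip (h (F x)) (diff_at V x u) (W x)"
    by (rule derivative_linear_family[OF open_S x sm(1) V linear_ip_left])
  also have "frechet_derivative (\<lambda>y. ip (h (F y)) (V x) (W y)) (at x) u
     = frechet_derivative (\<lambda>y. ip (h (F y)) (V x) (W x)) (at x) u + ip (h (F x)) (V x) (diff_at W x u)"
    by (rule derivative_linear_family[OF open_S x sm(2) W linear_ip_right])
  also have "frechet_derivative (\<lambda>y. ip (h (F y)) (V x) (W x)) (at x) u
     = ip (frechet_derivative h (at (F x)) (diff_at F x u)) (V x) (W x)"
    using derivative_compose[OF smooth_ip_const smooth_F x F_in[OF x]] derivative_ip_const[OF F_in[OF x]]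
    by simp
  finally show ?thesis
    by (simp add: nab_eq christoffel_metric[OF F_in[OF x]] ip_simps)
qed

text \<open>Covariant derivatives of \<open>dF p\<close> with a varying field \<open>p\<close> are reduced to constant \<open>p\<close>, for which they
  are components of the second fundamental form and the Christoffel symbols.\<close>

lemma nab_push:
  assumes x: "x \<in> S" and p: "smooth_on S p"
  shows "nab u (\<lambda>y. diff_at F y (p y)) x
    = nab u (\<lambda>y. diff_at F y (p x)) x + diff_at F x (diff_at p x u)"
  unfolding nab_eq using derivative_linear_family[OF open_S x smooth_dF p linear_dF] by simp

lemma nab_torsion_free:
  assumes x: "x \<in> S"
  shows "nab u (\<lambda>y. diff_at F y v) x = nab v (\<lambda>y. diff_at F y u) x"
  by (simp add: nab_eq second_derivative_symmetric[OF open_S x smooth_F, of v u]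
      christoffel_commute[OF F_in[OF x], of "diff_at F x v"])

text \<open>The derivatives of first order in \<open>V\<close> enter \<open>\<nabla>\<^sub>u \<nabla>\<^sub>v V\<close> symmetrically in \<open>u\<close> and \<open>v\<close>, and so do the
  second derivatives of \<open>V\<close> and of \<open>F\<close>; what is left is the coordinate formula for the curvature.\<close>

lemma nab_curvature:
  assumes x: "x \<in> S" and V: "smooth_on S V"
  shows "nab u (\<lambda>y. nab v V y) x - nab v (\<lambda>y. nab u V y) x
    = curvature h (F x) (diff_at F x u) (diff_at F x v) (V x)"
proof -
  let ?\<Gamma> = "christoffel h (F x)"
  have *: "nab u (\<lambda>y. nab v V y) x
     = diff_at (\<lambda>y. diff_at V y v) x u
       + diff_at (\<lambda>z. christoffel h z (diff_at F x v) (V x)) (F x) (diff_at F x u)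
       + ?\<Gamma> (diff_at (\<lambda>y. diff_at F y v) x u) (V x)
       + (?\<Gamma> (diff_at F x v) (diff_at V x u) + ?\<Gamma> (diff_at F x u) (diff_at V x v))
       + ?\<Gamma> (diff_at F x u) (?\<Gamma> (diff_at F x v) (V x))" for u v
  proof -
    have "diff_at (\<lambda>y. nab v V y) x u = diff_at (\<lambda>y. diff_at V y v) x u
        + diff_at (\<lambda>y. christoffel h (F y) (diff_at F y v) (V y)) x u"
      unfolding nab_eq
      by (subst frechet_derivative_eqI[OF has_derivative_add[OF
          smooth_on_has_derivative[OF smooth_on_derivative[OF V] x]
          smooth_on_has_derivative[OF smooth_christoffel_along[OF smooth_dF V] x]]]) simp
    then show ?thesis
      unfolding nab_eq[of u "\<lambda>y. nab v V y"]
      by (simp add: derivative_christoffel_along[OF x smooth_dF V] nab_eq[of v V x]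
          linear_add[OF linear_christoffel_right[OF F_in[OF x]]])
  qed
  show ?thesis
    unfolding * curvature_eq[OF F_in[OF x]]
    using second_derivative_symmetric[OF open_S x V, of u v]
      second_derivative_symmetric[OF open_S x smooth_F, of u v]
    by (simp add: algebra_simps)
qed

end

section \<open>Isometric immersions in charts\<close>

locale isometric_patch = patch_map T h S F + src: patch_map S g S "\<lambda>x. x"
  for T :: "(real ^ 'n::finite) set" and h :: "real ^ 'n \<Rightarrow> real ^ 'n ^ 'n"
    and S :: "(real ^ 'm::finite) set" and g :: "real ^ 'm \<Rightarrow> real ^ 'm ^ 'm"
    and F :: "real ^ 'm \<Rightarrow> real ^ 'n" +
  assumes isometry: "x \<in> S \<Longrightarrow> ip (h (F x)) (diff_at F x u) (diff_at F x v) = ip (g x) u v"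
begin

text \<open>For an isometric immersion, \<open>\<nabla>dF\<close> is the second fundamental form: see
  \<open>second_fundamental_form_eq\<close>.\<close>

abbreviation B :: "real ^ 'm \<Rightarrow> real ^ 'm \<Rightarrow> real ^ 'm \<Rightarrow> real ^ 'n" where
  "B x u v \<equiv> nabla_d g h F x u v"

abbreviation \<tau> :: "real ^ 'm \<Rightarrow> real ^ 'n" where
  "\<tau> \<equiv> tension_field g h F"

abbreviation frame :: "real ^ 'm \<Rightarrow> 'm \<Rightarrow> real ^ 'm" where
  "frame x \<equiv> some_frame (g x)"

lemma h_commute: "x \<in> S \<Longrightarrow> ip (h (F x)) a b = ip (h (F x)) b a"
  by (rule inner_product_matrix.ip_commute[OF inner_h[OF F_in]])

lemma frame_orthonormal: "x \<in> S \<Longrightarrow> orthonormal_frame (g x) (frame x)"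
  by (rule inner_product_matrix.orthonormal_some_frame[OF src.inner_h])

lemma B_eq: "B x u v = nab u (\<lambda>y. diff_at F y v) x - diff_at F x (christoffel g x u v)"
  by (simp add: nabla_d_def levi_civita_def)

lemma nab_dF: "nab u (\<lambda>y. diff_at F y v) x = B x u v + diff_at F x (christoffel g x u v)"
  by (simp add: B_eq)

lemma nab_push_src:
  assumes x: "x \<in> S" and p: "smooth_on S p"
  shows "nab u (\<lambda>y. diff_at F y (p y)) x = B x u (p x) + diff_at F x (src.nab u p x)"
  by (simp add: nab_push[OF x p] nab_dF src.nab_eq linear_add[OF linear_dF[OF x]])

lemma B_commute: "x \<in> S \<Longrightarrow> B x u v = B x v u"
  by (simp add: B_eq nab_torsion_free[of x u v] src.christoffel_commute[of x u v])

lemma linear_B_left: "x \<in> S \<Longrightarrow> linear (\<lambda>u. B x u v)"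
  unfolding B_eq
  by (intro linear_compose_sub linear_nab smooth_dF
      linear_compose[OF src.linear_christoffel_left linear_dF, unfolded o_def])

lemma linear_B_right:
  assumes "x \<in> S" shows "linear (B x u)"
proof -
  have "B x u = (\<lambda>v. B x v u)" by (rule ext) (rule B_commute[OF assms])
  then show ?thesis using linear_B_left[OF assms, of u] by simp
qed

lemma smooth_B: "smooth_on S (\<lambda>y. B y u v)"
  unfolding B_eq
  by (intro smooth_on_diff smooth_nab smooth_dF smooth_push src.smooth_christoffel open_S)

text \<open>\<open>h (B(u,v), dF w)\<close> is symmetric in \<open>u, v\<close>, as both connections are torsion free, and
  antisymmetric in \<open>v, w\<close>, as both are metric and \<open>F\<close> is an isometry; hence it vanishes.\<close>

lemma B_normal:
  assumes x: "x \<in> S" shows "ip (h (F x)) (B x u v) (diff_at F x w) = 0"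
proof -
  let ?t = "\<lambda>u v w. ip (h (F x)) (B x u v) (diff_at F x w)"
  have anti: "?t u v w = - ?t u w v" for u v w
  proof -
    have "frechet_derivative (\<lambda>y. ip (h (F y)) (diff_at F y v) (diff_at F y w)) (at x) u
        = frechet_derivative (\<lambda>y. ip (g y) v w) (at x) u"
      by (rule fun_cong[OF frechet_derivative_cong_open[OF open_S x isometry]])
    then show ?thesis
      using src.derivative_ip_const[OF x, of v w u] src.christoffel_metric[OF x, of u v w]
      by (simp add: nab_metric[OF x smooth_dF smooth_dF] nab_dF ip_simps isometry[OF x]
          h_commute[OF x, of "diff_at F x v" "B x u w"])
  qed
  have sym: "?t u v w = ?t v u w" for u v w
    by (simp add: B_commute[OF x, of u v])
  have "?t u v w = - ?t u w v" by (rule anti)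
  also have "\<dots> = - ?t w u v" by (simp add: sym[of u w])
  also have "\<dots> = ?t w v u" by (simp add: anti[of w u v])
  also have "\<dots> = ?t v w u" by (rule sym)
  also have "\<dots> = - ?t v u w" by (rule anti)
  also have "\<dots> = - ?t u v w" by (simp add: sym[of v u])
  finally show ?thesis by simp
qed

lemma dF_B: "x \<in> S \<Longrightarrow> ip (h (F x)) (diff_at F x w) (B x u v) = 0"
  using B_normal h_commute by metis

text \<open>\<open>\<nabla>\<^sub>u (dF v)\<close> is the sum of the normal vector \<open>B(u,v)\<close> and the tangent vector \<open>dF (\<nabla>\<^sub>u v)\<close>, and the
  projection to the tangent space reproduces the latter.\<close>

lemma second_fundamental_form_eq:
  assumes x: "x \<in> S" shows "second_fundamental_form g h F x u v = B x u v"
proof -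
  let ?c = "christoffel g x u v"
  have "(\<Sum>i\<in>UNIV. ip (h (F x)) (B x u v + diff_at F x ?c) (diff_at F x (frame x i)) *\<^sub>R diff_at F x (frame x i))
      = diff_at F x (\<Sum>i\<in>UNIV. ip (g x) ?c (frame x i) *\<^sub>R frame x i)"
    by (simp add: ip_simps B_normal[OF x] isometry[OF x] linear_sum[OF linear_dF[OF x]]
        linear_scale[OF linear_dF[OF x]])
  also have "(\<Sum>i\<in>UNIV. ip (g x) ?c (frame x i) *\<^sub>R frame x i) = ?c"
    by (rule inner_product_matrix.orthonormal_frame_expansion[OF src.inner_h[OF x] frame_orthonormal[OF x], symmetric])
  finally show ?thesis
    by (simp add: second_fundamental_form_def normal_part_def frame_sum_some_frame nab_dF)
qed

lemma mean_curvature_vector_eq: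
  "x \<in> S \<Longrightarrow> mean_curvature_vector g h F x = (1 / real CARD('m)) *\<^sub>R \<tau> x"
  by (simp add: mean_curvature_vector_def tension_field_def second_fundamental_form_eq)

lemma mean_curvature_length_eq:
  assumes x: "x \<in> S" and H: "mean_curvature_length g h F x = \<bar>H\<bar>"
  shows "ip (h (F x)) (\<tau> x) (\<tau> x) = (real CARD('m) * H)\<^sup>2"
proof -
  have "ip (h (F x)) (\<tau> x) (\<tau> x) \<ge> 0"
    using inner_product_matrix.ip_pos[OF inner_h[OF F_in[OF x]], of "\<tau> x"]
    by (cases "\<tau> x = 0") (auto simp: ip_simps)
  then have "(mean_curvature_length g h F x)\<^sup>2 = ip (h (F x)) (\<tau> x) (\<tau> x) / (real CARD('m))\<^sup>2"
    by (simp add: mean_curvature_length_def mean_curvature_vector_eq[OF x] ip_simps power2_eq_square)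
  then show ?thesis by (simp add: H power_mult_distrib field_simps)
qed

text \<open>The orthonormal frames used in the definition of the trace need not vary continuously with
  the point, but the trace can be contracted with the inverse metric instead.\<close>

lemma tension_field_contraction:
  assumes "y \<in> S"
  shows "\<tau> y = (\<Sum>j\<in>UNIV. B y (axis j 1) (matrix_inv (g y) *v axis j 1))"
  using inner_product_matrix.trace_orthonormal_frame[OF src.inner_h[OF assms] frame_orthonormal[OF assms],
      of "B y"] linear_B_left[OF assms] linear_B_right[OF assms]
  by (simp add: tension_field_def frame_sum_some_frame)

lemma smooth_inverse_metric: "smooth_on S (\<lambda>y. matrix_inv (g y) *v w)"
  by (intro smooth_on_matrix_inv src.smooth_h open_S inner_product_matrix.invertible src.inner_h)

lemma smooth_tension_field: "smooth_on S \<tau>"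
proof (rule smooth_on_cong[OF _ open_S tension_field_contraction[symmetric]])
  show "smooth_on S (\<lambda>y. \<Sum>j\<in>UNIV. B y (axis j 1) (matrix_inv (g y) *v axis j 1))"
    by (intro smooth_on_sum smooth_on_linear_family[OF open_S smooth_B smooth_inverse_metric]
        linear_B_right open_S)
qed

text \<open>The inverse metric is parallel: when the contraction of a bilinear form \<open>q\<close> with it is
  differentiated covariantly, the terms that do not differentiate \<open>q\<close> cancel. Indeed the column
  \<open>p\<^sub>j\<close> of the inverse metric satisfies \<open>g (p\<^sub>j, v) = v\<^sub>j\<close> for all constant \<open>v\<close>, and differentiating this
  gives \<open>g (\<nabla>\<^sub>w p\<^sub>j, v) = - \<Gamma>(w, v)\<^sub>j\<close>.\<close>

lemma inverse_metric_parallel: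
  fixes q :: "real ^ 'm \<Rightarrow> real ^ 'm \<Rightarrow> real"
  assumes x: "x \<in> S" and lin: "\<And>u. linear (q u)" "\<And>v. linear (\<lambda>u. q u v)"
  shows "(\<Sum>j\<in>UNIV. q (christoffel g x w (axis j 1)) (matrix_inv (g x) *v axis j 1)
      + q (axis j 1) (src.nab w (\<lambda>y. matrix_inv (g y) *v axis j 1) x)) = 0"
proof -
  interpret gx: inner_product_matrix "g x" by (rule src.inner_h[OF x])
  let ?E = "frame x" and ?\<Gamma> = "christoffel g x w" and ?p = "\<lambda>j y. matrix_inv (g y) *v axis j 1"
  have coord: "ip (g x) (src.nab w (?p j) x) (?E k) = - (?\<Gamma> (?E k) $ j)" for j k
  proof -
    have p: "ip (g y) (?p j y) v = v $ j" if "y \<in> S" for y v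
      using inner_product_matrix.ip_matrix_inv[OF src.inner_h[OF that]]
      by (simp add: inner_axis' inner_axis)
    have "frechet_derivative (\<lambda>y. ip (g y) (?p j y) (?E k)) (at x)
        = frechet_derivative (\<lambda>y. ?E k $ j) (at x)"
      by (rule frechet_derivative_cong_open[OF open_S x p])
    then have "frechet_derivative (\<lambda>y. ip (g y) (?p j y) (?E k)) (at x) w = 0" by simp
    then show ?thesis
      using src.nab_metric[OF x smooth_inverse_metric smooth_on_const, of "axis j 1" "?E k" w] p[OF x]
      by (simp add: src.nab_eq[of w "\<lambda>_. ?E k"])
  qed
  have "q (axis j 1) (src.nab w (?p j) x) = - (\<Sum>k\<in>UNIV. ?\<Gamma> (?E k) $ j * q (axis j 1) (?E k))" for j
    by (subst gx.orthonormal_frame_expansion[OF frame_orthonormal[OF x], of "src.nab w (?p j) x"])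
       (simp add: coord linear_sum[OF lin(1)] linear_neg[OF lin(1)] linear_scale[OF lin(1)] sum_negf)
  then have "(\<Sum>j\<in>UNIV. q (axis j 1) (src.nab w (?p j) x))
      = - (\<Sum>j\<in>UNIV. \<Sum>k\<in>UNIV. ?\<Gamma> (?E k) $ j * q (axis j 1) (?E k))"
    by (simp add: sum_negf)
  also have "(\<Sum>j\<in>UNIV. \<Sum>k\<in>UNIV. ?\<Gamma> (?E k) $ j * q (axis j 1) (?E k))
      = (\<Sum>k\<in>UNIV. \<Sum>j\<in>UNIV. ?\<Gamma> (?E k) $ j * q (axis j 1) (?E k))"
    by (rule sum.swap)
  also have "\<dots> = (\<Sum>k\<in>UNIV. q (?\<Gamma> (?E k)) (?E k))"
  proof (rule sum.cong)
    fix k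
    have "q (\<Sum>j\<in>UNIV. (?\<Gamma> (?E k) $ j) *\<^sub>R axis j 1) (?E k) = (\<Sum>j\<in>UNIV. ?\<Gamma> (?E k) $ j * q (axis j 1) (?E k))"
      by (simp add: linear_sum[OF lin(2)] linear_scale[OF lin(2)])
    moreover have "(\<Sum>j\<in>UNIV. (?\<Gamma> (?E k) $ j) *\<^sub>R axis j 1) = ?\<Gamma> (?E k)"
      using basis_expansion[of "?\<Gamma> (?E k)"] by (simp add: scalar_mult_eq_scaleR)
    ultimately show "(\<Sum>j\<in>UNIV. ?\<Gamma> (?E k) $ j * q (axis j 1) (?E k)) = q (?\<Gamma> (?E k)) (?E k)" by simp
  qed simp
  also have "\<dots> = (\<Sum>j\<in>UNIV. q (?\<Gamma> (axis j 1)) (?p j x))"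
    by (rule gx.trace_orthonormal_frame[OF frame_orthonormal[OF x], symmetric])
       (intro lin linear_compose[OF src.linear_christoffel_right[OF x] lin(2), unfolded o_def])+
  finally show ?thesis by (simp add: sum.distrib)
qed

lemma second_covariant_derivative_eq:
  "second_covariant_derivative g h F V x u v
    = nab u (\<lambda>y. nab v V y) x - nab (christoffel g x u v) V x"
  by (simp add: second_covariant_derivative_def pullback_connection_pointwise[of "levi_civita g _ _"]
      levi_civita_def)

lemma second_covariant_derivative_commutator:
  assumes x: "x \<in> S" and V: "smooth_on S V"
  shows "second_covariant_derivative g h F V x u v - second_covariant_derivative g h F V x v u
    = curvature h (F x) (diff_at F x u) (diff_at F x v) (V x)"
  using nab_curvature[OF x V, of u v]
  by (simp add: second_covariant_derivative_eq src.christoffel_commute[OF x, of u v])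

lemma linear_second_covariant_derivative:
  assumes x: "x \<in> S" and V: "smooth_on S V"
  shows "linear (second_covariant_derivative g h F V x u)"
  unfolding second_covariant_derivative_eq[abs_def]
  by (intro linear_compose_sub linear_nab_nab[OF x V]
      linear_compose[OF src.linear_christoffel_right[OF x] linear_nab[OF x V], unfolded o_def])

text \<open>The equation of Gauss. The tangential part of \<open>\<nabla>\<^sub>v (dF w)\<close> is \<open>dF (\<nabla>\<^sub>v w)\<close>, so
  \<open>h (\<nabla>\<^sub>v (dF w), dF a) = g (\<nabla>\<^sub>v w, a)\<close>; differentiating both sides along \<open>u\<close> compares the two iterated
  derivatives, and antisymmetrizing in \<open>u\<close> and \<open>v\<close> gives the curvatures.\<close>

lemma gauss_equation:
  assumes x: "x \<in> S"
  shows "ip (g x) (curvature g x u v w) a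
    = ip (h (F x)) (curvature h (F x) (diff_at F x u) (diff_at F x v) (diff_at F x w)) (diff_at F x a)
      + ip (h (F x)) (B x v w) (B x u a) - ip (h (F x)) (B x u w) (B x v a)"
proof -
  have *: "ip (h (F x)) (nab u (\<lambda>y. nab v (\<lambda>y. diff_at F y w) y) x) (diff_at F x a)
      = ip (g x) (src.nab u (\<lambda>y. src.nab v (\<lambda>_. w) y) x) a - ip (h (F x)) (B x v w) (B x u a)" for u v
  proof -
    let ?Z = "\<lambda>y. src.nab v (\<lambda>_. w) y"
    have Z: "?Z y = christoffel g y v w" for y by (simp add: src.nab_eq)
    have tangential: "ip (h (F y)) (nab v (\<lambda>y. diff_at F y w) y) (diff_at F y a) = ip (g y) (?Z y) a" if "y \<in> S" for y
      by (simp add: nab_dF ip_simps B_normal[OF that] isometry[OF that] Z)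
    have "frechet_derivative (\<lambda>y. ip (h (F y)) (nab v (\<lambda>y. diff_at F y w) y) (diff_at F y a)) (at x) u
        = frechet_derivative (\<lambda>y. ip (g y) (?Z y) a) (at x) u"
      by (rule fun_cong[OF frechet_derivative_cong_open[OF open_S x tangential]])
    then have "ip (h (F x)) (nab u (\<lambda>y. nab v (\<lambda>y. diff_at F y w) y) x) (diff_at F x a)
        + ip (h (F x)) (nab v (\<lambda>y. diff_at F y w) x) (nab u (\<lambda>y. diff_at F y a) x)
        = ip (g x) (src.nab u ?Z x) a + ip (g x) (?Z x) (src.nab u (\<lambda>_. a) x)"
      by (simp only: nab_metric[OF x smooth_nab[OF smooth_dF] smooth_dF]
          src.nab_metric[OF x src.smooth_nab[OF smooth_on_const] smooth_on_const])
    moreover have "ip (h (F x)) (nab v (\<lambda>y. diff_at F y w) x) (nab u (\<lambda>y. diff_at F y a) x)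
        = ip (h (F x)) (B x v w) (B x u a) + ip (g x) (?Z x) (src.nab u (\<lambda>_. a) x)"
      by (simp add: nab_dF ip_simps B_normal[OF x] dF_B[OF x] isometry[OF x] src.nab_eq)
    ultimately show ?thesis by simp
  qed
  have "ip (h (F x)) (curvature h (F x) (diff_at F x u) (diff_at F x v) (diff_at F x w)) (diff_at F x a)
      = ip (h (F x)) (nab u (\<lambda>y. nab v (\<lambda>y. diff_at F y w) y) x) (diff_at F x a)
        - ip (h (F x)) (nab v (\<lambda>y. nab u (\<lambda>y. diff_at F y w) y) x) (diff_at F x a)"
    by (simp only: nab_curvature[OF x smooth_dF, symmetric] ip_simps)
  moreover have "curvature g x u v w
      = src.nab u (\<lambda>y. src.nab v (\<lambda>_. w) y) x - src.nab v (\<lambda>y. src.nab u (\<lambda>_. w) y) x"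
    using src.nab_curvature[OF x smooth_on_const[of S w], of u v] by simp
  ultimately show ?thesis unfolding * by (simp add: ip_simps)
qed

end

section \<open>Hypersurfaces of constant mean curvature\<close>

text \<open>The constant \<open>k\<close> is the squared length of the tension field, that is \<open>m\<^sup>2 H\<^sup>2\<close>. Since it is positive, the
  tension field spans the normal line at every point.\<close>

locale cmc_hypersurface_patch = isometric_patch T h S g F
  for T :: "(real ^ 'n::finite) set" and h :: "real ^ 'n \<Rightarrow> real ^ 'n ^ 'n"
    and S :: "(real ^ 'm::finite) set" and g :: "real ^ 'm \<Rightarrow> real ^ 'm ^ 'm"
    and F :: "real ^ 'm \<Rightarrow> real ^ 'n" +
  fixes k :: real
  assumes codim: "CARD('n) = CARD('m) + 1"
    and tension_length: "x \<in> S \<Longrightarrow> ip (h (F x)) (\<tau> x) (\<tau> x) = k"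
    and k_pos: "k > 0"
begin

abbreviation b :: "real ^ 'm \<Rightarrow> real ^ 'm \<Rightarrow> real ^ 'm \<Rightarrow> real" where
  "b x u v \<equiv> ip (h (F x)) (B x u v) (\<tau> x)"

lemma tension_eq: "\<tau> x = (\<Sum>i\<in>UNIV. B x (frame x i) (frame x i))"
  by (simp add: tension_field_def frame_sum_some_frame)

lemma dF_tension: "x \<in> S \<Longrightarrow> ip (h (F x)) (diff_at F x w) (\<tau> x) = 0"
  by (simp add: tension_eq ip_sum_right dF_B)

lemma tension_dF: "x \<in> S \<Longrightarrow> ip (h (F x)) (\<tau> x) (diff_at F x w) = 0"
  using dF_tension h_commute by metis

lemma hyperplane:
  assumes x: "x \<in> S" shows "hyperplane_frame (h (F x)) (\<lambda>i. diff_at F x (frame x i)) (\<tau> x)"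
proof -
  interpret inner_product_matrix "h (F x)" by (rule inner_h[OF F_in[OF x]])
  show ?thesis
  proof
    show "ip (h (F x)) (diff_at F x (frame x i)) (diff_at F x (frame x j)) = (if i = j then 1 else 0)" for i j
      using frame_orthonormal[OF x] by (simp add: isometry[OF x] orthonormal_frame_def)
    show "\<tau> x \<noteq> 0" using tension_length[OF x] k_pos by (auto simp: ip_simps)
  qed (simp_all add: codim dF_tension[OF x])
qed

lemma B_tension: "x \<in> S \<Longrightarrow> B x u v = (b x u v / k) *\<^sub>R \<tau> x"
  using hyperplane_frame.normal_multiple[OF hyperplane, of x "B x u v"]
  by (simp add: B_normal tension_length)

lemma ip_B_B: "x \<in> S \<Longrightarrow> ip (h (F x)) (B x u v) (B x w a) = b x u v * b x w a / k"
  by (subst B_tension[of x w a]) (simp_all add: ip_simps mult.commute)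

lemma sum_b: "x \<in> S \<Longrightarrow> (\<Sum>i\<in>UNIV. b x (frame x i) (frame x i)) = k"
  by (simp add: ip_sum_left[symmetric] tension_eq[symmetric] tension_length)

lemma linear_b_left: "x \<in> S \<Longrightarrow> linear (\<lambda>u. b x u v)"
  using linear_compose[OF linear_B_left linear_ip_left] by (simp add: o_def)

lemma linear_b_right: "x \<in> S \<Longrightarrow> linear (b x u)"
  using linear_compose[OF linear_B_right linear_ip_left] by (simp add: o_def)

subsection \<open>The derivatives of the tension field\<close>

lemma nab_tension_tension:
  assumes x: "x \<in> S" shows "ip (h (F x)) (nab u \<tau> x) (\<tau> x) = 0"
proof -
  have "frechet_derivative (\<lambda>y. ip (h (F y)) (\<tau> y) (\<tau> y)) (at x) u = 0"
    by (rule derivative_constant[OF x tension_length])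
  then show ?thesis
    by (simp add: nab_metric[OF x smooth_tension_field smooth_tension_field] h_commute[OF x, of "\<tau> x"])
qed

lemma nab_tension_dF:
  assumes x: "x \<in> S" shows "ip (h (F x)) (nab u \<tau> x) (diff_at F x w) = - b x u w"
proof -
  have "frechet_derivative (\<lambda>y. ip (h (F y)) (\<tau> y) (diff_at F y w)) (at x) u = 0"
    by (rule derivative_constant[OF x tension_dF])
  then show ?thesis
    by (simp add: nab_metric[OF x smooth_tension_field smooth_dF] nab_dF ip_simps tension_dF[OF x]
        h_commute[OF x, of "\<tau> x" "B x u w"])
qed

lemma nab_tension_B:
  assumes x: "x \<in> S" shows "ip (h (F x)) (nab v \<tau> x) (B x u w) = 0"
  by (subst B_tension[OF x]) (simp add: ip_simps nab_tension_tension[OF x])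

text \<open>Only the tangential part \<open>dF (\<nabla>\<^sub>u p)\<close> of \<open>\<nabla>\<^sub>u (dF p)\<close> matters, because \<open>\<nabla>\<^sub>v \<tau>\<close> is tangent.\<close>

lemma nab_tension_nab_push:
  assumes x: "x \<in> S" and p: "smooth_on S p"
  shows "ip (h (F x)) (nab v \<tau> x) (nab u (\<lambda>y. diff_at F y (p y)) x) = - b x v (src.nab u p x)"
  by (simp add: nab_push_src[OF x p] ip_simps nab_tension_B[OF x] nab_tension_dF[OF x])

abbreviation Hess :: "real ^ 'm \<Rightarrow> real ^ 'm \<Rightarrow> real ^ 'm \<Rightarrow> real ^ 'n" where
  "Hess x u v \<equiv> second_covariant_derivative g h F \<tau> x u v"

lemma nab_nab_tension:
  "nab u (\<lambda>y. nab v \<tau> y) x = Hess x u v + nab (christoffel g x u v) \<tau> x"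
  by (simp add: second_covariant_derivative_eq)

lemma Hess_tension:
  assumes x: "x \<in> S"
  shows "ip (h (F x)) (Hess x u v) (\<tau> x) = - ip (h (F x)) (nab u \<tau> x) (nab v \<tau> x)"
proof -
  have "frechet_derivative (\<lambda>y. ip (h (F y)) (nab v \<tau> y) (\<tau> y)) (at x) u = 0"
    by (rule derivative_constant[OF x nab_tension_tension])
  then show ?thesis
    by (simp add: nab_metric[OF x smooth_nab[OF smooth_tension_field] smooth_tension_field]
        nab_nab_tension ip_simps nab_tension_tension[OF x] h_commute[OF x, of "nab u \<tau> x"])
qed

text \<open>The derivative along \<open>u\<close> of the symmetry \<open>h (\<nabla>\<^sub>v \<tau>, dF w) = h (\<nabla>\<^sub>w \<tau>, dF v)\<close>, which in turn is that
  of \<open>B\<close>. Together with the commutator of second covariant derivatives this is the Codazzi equation.\<close>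

lemma Hess_dF_symmetric:
  assumes x: "x \<in> S"
  shows "ip (h (F x)) (Hess x u v) (diff_at F x w) = ip (h (F x)) (Hess x u w) (diff_at F x v)"
proof -
  have *: "frechet_derivative (\<lambda>y. ip (h (F y)) (nab v \<tau> y) (diff_at F y w)) (at x) u
      = ip (h (F x)) (Hess x u v) (diff_at F x w) - b x (christoffel g x u v) w - b x v (christoffel g x u w)"
    for v w
    using nab_tension_nab_push[OF x smooth_on_const[of S w], of v u]
    by (simp add: nab_metric[OF x smooth_nab[OF smooth_tension_field] smooth_dF]
        nab_nab_tension ip_simps nab_tension_dF[OF x] src.nab_eq)
  have "ip (h (F y)) (nab v \<tau> y) (diff_at F y w) = ip (h (F y)) (nab w \<tau> y) (diff_at F y v)" if "y \<in> S" for y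
    using that by (simp add: nab_tension_dF B_commute[of y v w])
  then have "frechet_derivative (\<lambda>y. ip (h (F y)) (nab v \<tau> y) (diff_at F y w)) (at x) u
      = frechet_derivative (\<lambda>y. ip (h (F y)) (nab w \<tau> y) (diff_at F y v)) (at x) u"
    by (rule fun_cong[OF frechet_derivative_cong_open[OF open_S x]])
  then show ?thesis
    unfolding * by (simp add: B_commute[OF x, of v] B_commute[OF x, of w])
qed

text \<open>Here the constancy of the mean curvature enters a second time: \<open>h (\<tau>, \<tau>) = k\<close> is the contraction of
  \<open>- h (\<nabla>\<^sub>u \<tau>, dF v)\<close> with the inverse metric, which is parallel, so the derivative of \<open>k\<close> along \<open>w\<close> is
  minus the trace in question.\<close>

lemma trace_Hess_dF:
  assumes x: "x \<in> S"
  shows "(\<Sum>i\<in>UNIV. ip (h (F x)) (Hess x w (frame x i)) (diff_at F x (frame x i))) = 0"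
proof -
  let ?e = "\<lambda>j::'m. axis j 1 :: real ^ 'm" and ?p = "\<lambda>j y. matrix_inv (g y) *v axis j 1"
  let ?f = "\<lambda>j y. ip (h (F y)) (nab (?e j) \<tau> y) (diff_at F y (?p j y))"
  have sm: "smooth_on S (?f j)" for j
    by (intro smooth_ip_along smooth_nab smooth_tension_field smooth_push smooth_inverse_metric)
  have "(\<Sum>j\<in>UNIV. ?f j y) = - k" if y: "y \<in> S" for y
  proof -
    have "(\<Sum>j\<in>UNIV. ?f j y) = - ip (h (F y)) (\<Sum>j\<in>UNIV. B y (?e j) (?p j y)) (\<tau> y)"
      by (simp add: nab_tension_dF[OF y] sum_negf ip_sum_left)
    then show ?thesis
      by (simp add: tension_field_contraction[OF y, symmetric] tension_length[OF y])
  qed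
  then have "frechet_derivative (\<lambda>y. \<Sum>j\<in>UNIV. ?f j y) (at x) w = 0"
    by (rule derivative_constant[OF x])
  moreover have "frechet_derivative (\<lambda>y. \<Sum>j\<in>UNIV. ?f j y) (at x)
      = (\<lambda>w. \<Sum>j\<in>UNIV. frechet_derivative (?f j) (at x) w)"
    by (intro frechet_derivative_eqI has_derivative_sum smooth_on_has_derivative[OF sm x])
  moreover have "frechet_derivative (?f j) (at x) w
      = ip (h (F x)) (Hess x w (?e j)) (diff_at F x (?p j x))
        - (b x (christoffel g x w (?e j)) (?p j x) + b x (?e j) (src.nab w (?p j) x))" for j
    by (simp add: nab_metric[OF x smooth_nab[OF smooth_tension_field] smooth_push[OF smooth_inverse_metric]]
        nab_tension_nab_push[OF x smooth_inverse_metric] nab_nab_tension nab_tension_dF[OF x] ip_simps)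
  ultimately have "(\<Sum>j\<in>UNIV. ip (h (F x)) (Hess x w (?e j)) (diff_at F x (?p j x)))
      = (\<Sum>j\<in>UNIV. b x (christoffel g x w (?e j)) (?p j x) + b x (?e j) (src.nab w (?p j) x))"
    by (simp add: sum_subtractf)
  also have "\<dots> = 0"
    by (rule inverse_metric_parallel[OF x linear_b_right[OF x] linear_b_left[OF x]])
  finally have "(\<Sum>j\<in>UNIV. ip (h (F x)) (Hess x w (?e j)) (diff_at F x (?p j x))) = 0" .
  then show ?thesis
    using inner_product_matrix.trace_orthonormal_frame[OF src.inner_h[OF x] frame_orthonormal[OF x],
        of "\<lambda>u v. ip (h (F x)) (Hess x w u) (diff_at F x v)"]
      linear_compose[OF linear_dF[OF x] linear_ip_right]
      linear_compose[OF linear_second_covariant_derivative[OF x smooth_tension_field] linear_ip_left]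
    by (simp add: o_def)
qed

end

section \<open>Hypersurfaces of generalized complex space forms\<close>

locale cmc_hypersurface_in_space_form_patch = cmc_hypersurface_patch T h S g F k
  for T :: "(real ^ 'n::finite) set" and h :: "real ^ 'n \<Rightarrow> real ^ 'n ^ 'n"
    and S :: "(real ^ 'm::finite) set" and g :: "real ^ 'm \<Rightarrow> real ^ 'm ^ 'm"
    and F :: "real ^ 'm \<Rightarrow> real ^ 'n" and k +
  fixes J :: "real ^ 'n \<Rightarrow> real ^ 'n ^ 'n" and \<alpha> \<beta> :: "real ^ 'n \<Rightarrow> real"
  assumes J_J: "z \<in> T \<Longrightarrow> J z *v (J z *v u) = - u"
    and J_isometry: "z \<in> T \<Longrightarrow> ip (h z) (J z *v u) (J z *v v) = ip (h z) u v"
    and curvature_h: "z \<in> T \<Longrightarrow> curvature h z u v w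
      = \<alpha> z *\<^sub>R R1 (h z) u v w + \<beta> z *\<^sub>R R2 (h z) (J z) u v w"
begin

lemma hermitian:
  assumes x: "x \<in> S"
  shows "hermitian_hyperplane (h (F x)) (\<lambda>i. diff_at F x (frame x i)) (\<tau> x) (J (F x))"
proof -
  interpret hyperplane_frame "h (F x)" "\<lambda>i. diff_at F x (frame x i)" "\<tau> x" by (rule hyperplane[OF x])
  show ?thesis
    by unfold_locales (simp_all add: J_J J_isometry F_in[OF x])
qed

lemma norm_sq_eq:
  assumes x: "x \<in> S"
  shows "second_fundamental_form_norm_sq g h F x
    = (\<Sum>i\<in>UNIV. \<Sum>j\<in>UNIV. (b x (frame x i) (frame x j))\<^sup>2) / k"
  by (simp add: second_fundamental_form_norm_sq_def frame_sum_some_frame second_fundamental_form_eq[OF x]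
      ip_B_B[OF x] sum_divide_distrib power2_eq_square)

text \<open>The tangential part vanishes by the trace of the Codazzi equation, and the
  product with \<open>\<tau>\<close> is minus the squared length of \<open>\<nabla>\<tau>\<close>.\<close>

lemma rough_laplacian_tension:
  assumes x: "x \<in> S"
  shows "rough_laplacian g h F \<tau> x = - (second_fundamental_form_norm_sq g h F x *\<^sub>R \<tau> x)"
proof -
  let ?L = "rough_laplacian g h F \<tau> x" and ?E = "frame x"
  interpret hermitian_hyperplane "h (F x)" "\<lambda>i. diff_at F x (?E i)" "\<tau> x" "J (F x)"
    by (rule hermitian[OF x])
  have L: "?L = (\<Sum>i\<in>UNIV. Hess x (?E i) (?E i))"
    by (simp add: rough_laplacian_def frame_sum_some_frame)
  have tangential: "ip (h (F x)) ?L (diff_at F x w) = 0" for w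
  proof -
    have "ip (h (F x)) ?L (diff_at F x w)
        = (\<Sum>i\<in>UNIV. ip (h (F x)) (Hess x (?E i) w) (diff_at F x (?E i)))"
      by (simp add: L ip_sum_left Hess_dF_symmetric[OF x, of _ _ w])
    also have "\<dots> = (\<Sum>i\<in>UNIV. ip (h (F x)) (Hess x w (?E i)) (diff_at F x (?E i)))
        + (\<Sum>i\<in>UNIV. ip (h (F x)) (curvature h (F x) (diff_at F x (?E i)) (diff_at F x w) (\<tau> x))
            (diff_at F x (?E i)))"
      by (simp add: second_covariant_derivative_commutator[OF x smooth_tension_field, symmetric]
          ip_simps sum_subtractf)
    also have "\<dots> = 0"
      by (simp add: trace_Hess_dF[OF x] curvature_h[OF F_in[OF x]] sum_R1_R2_tangent dF_tension[OF x])
    finally show ?thesis .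
  qed
  have "ip (h (F x)) (nab u \<tau> x) (nab u \<tau> x) = (\<Sum>j\<in>UNIV. (b x u (?E j))\<^sup>2)" for u
    using parseval[of "nab u \<tau> x" "nab u \<tau> x"]
    by (simp add: nab_tension_dF[OF x] nab_tension_tension[OF x] power2_eq_square)
  then have "ip (h (F x)) ?L (\<tau> x) = - (k * second_fundamental_form_norm_sq g h F x)"
    using k_pos by (simp add: L ip_sum_left Hess_tension[OF x] norm_sq_eq[OF x] sum_negf)
  moreover have "?L = (ip (h (F x)) ?L (\<tau> x) / k) *\<^sub>R \<tau> x"
    using normal_multiple[OF tangential] by (simp add: tension_length[OF x])
  ultimately show ?thesis using k_pos by simp
qed

lemma bitension_field_eq:
  assumes x: "x \<in> S"
  shows "bitension_field g h F x = (real CARD('m) * \<alpha> (F x) + 3 * \<beta> (F x)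
    - second_fundamental_form_norm_sq g h F x) *\<^sub>R \<tau> x"
proof -
  interpret hermitian_hyperplane "h (F x)" "\<lambda>i. diff_at F x (frame x i)" "\<tau> x" "J (F x)"
    by (rule hermitian[OF x])
  show ?thesis
    by (simp add: bitension_field_def frame_sum_some_frame rough_laplacian_tension[OF x]
        curvature_h[OF F_in[OF x]] sum_R1_R2_normal scaleR_left_diff_distrib)
qed

text \<open>The trace of the equation of Gauss.\<close>

lemma scalar_curvature_eq:
  assumes x: "x \<in> S"
  shows "scalar_curvature g x = (real CARD('m) - 1) * (real CARD('m) * \<alpha> (F x) + 3 * \<beta> (F x))
    + k - second_fundamental_form_norm_sq g h F x"
proof -
  interpret hermitian_hyperplane "h (F x)" "\<lambda>i. diff_at F x (frame x i)" "\<tau> x" "J (F x)"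
    by (rule hermitian[OF x])
  let ?E = "frame x"
  have "scalar_curvature g x = (\<Sum>i\<in>UNIV. \<Sum>j\<in>UNIV. ip (g x) (curvature g x (?E i) (?E j) (?E j)) (?E i))"
    by (simp add: scalar_curvature_def frame_sum_some_frame)
  also have "\<dots> = (real CARD('m) - 1) * (real CARD('m) * \<alpha> (F x) + 3 * \<beta> (F x))
      + (\<Sum>i\<in>UNIV. \<Sum>j\<in>UNIV. b x (?E j) (?E j) * b x (?E i) (?E i)) / k
      - (\<Sum>i\<in>UNIV. \<Sum>j\<in>UNIV. (b x (?E i) (?E j))\<^sup>2) / k"
    by (simp add: gauss_equation[OF x] curvature_h[OF F_in[OF x]] ip_B_B[OF x] sum.distrib sum_subtractf
        sum_R1_R2_scalar sum_divide_distrib power2_eq_square B_commute[OF x, of "?E j" "?E i" for i j])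
  also have "(\<Sum>i\<in>UNIV. \<Sum>j\<in>UNIV. b x (?E j) (?E j) * b x (?E i) (?E i)) = k * k"
    by (simp add: sum_distrib_left[symmetric] sum_distrib_right[symmetric] sum_b[OF x])
  finally show ?thesis using k_pos by (simp add: norm_sq_eq[OF x])
qed

end

section \<open>From charts to manifolds\<close>

lemma chart_facts:
  assumes M: "smooth_manifold M" and c: "c \<in> charts M"
  shows chart_openin: "openin (mtop M) (fst c)" and chart_open_image: "open (snd c ` fst c)"
    and chart_homeomorphic: "homeomorphic_map (subtopology (mtop M) (fst c)) (top_of_set (snd c ` fst c)) (snd c)"
    and chart_subset: "fst c \<subseteq> topspace (mtop M)" and chart_inj: "inj_on (snd c) (fst c)"
proof -
  show 1: "openin (mtop M) (fst c)" and "open (snd c ` fst c)"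
    and 2: "homeomorphic_map (subtopology (mtop M) (fst c)) (top_of_set (snd c ` fst c)) (snd c)"
    using M c unfolding smooth_manifold_def by blast+
  show 3: "fst c \<subseteq> topspace (mtop M)" using 1 by (rule openin_subset)
  show "inj_on (snd c) (fst c)"
    using homeomorphic_imp_injective_map[OF 2] 3 by (simp add: Int_absorb1)
qed

lemma chart_inv_chart: "smooth_manifold M \<Longrightarrow> c \<in> charts M \<Longrightarrow> p \<in> fst c \<Longrightarrow> chart_inv c (snd c p) = p"
  by (simp add: chart_inj)

lemma chart_exists:
  assumes "smooth_manifold M" "p \<in> topspace (mtop M)"
  shows "\<exists>c\<in>charts M. p \<in> fst c"
  using assms unfolding smooth_manifold_def by blast

lemma local_rep_chart:
  assumes "smooth_manifold M" "(c, d) \<in> charts_around M N \<psi> p"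
  shows "local_rep c d \<psi> (snd c p) = snd d (\<psi> p)"
  using assms by (simp add: local_rep_def charts_around_def chart_inv_chart)

lemma in_local_dom: "(c, d) \<in> charts_around M N \<psi> p \<Longrightarrow> snd c p \<in> local_dom c d \<psi>"
  by (auto simp: charts_around_def local_dom_def)

lemma local_domE:
  assumes "x \<in> local_dom c d \<psi>" "c \<in> charts M" "d \<in> charts N"
  obtains q where "x = snd c q" "(c, d) \<in> charts_around M N \<psi> q"
  using assms by (auto simp: charts_around_def local_dom_def)

text \<open>Coordinate maps are homeomorphisms onto open sets, hence open.\<close>

lemma open_local_dom:
  assumes M: "smooth_manifold M" and N: "smooth_manifold N" and "continuous_map (mtop M) (mtop N) \<psi>"
    and c: "c \<in> charts M" and d: "d \<in> charts N"
  shows "open (local_dom c d \<psi>)"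
proof -
  have "openin (mtop M) {x \<in> topspace (mtop M). \<psi> x \<in> fst d}"
    by (rule openin_continuous_map_preimage[OF assms(3) chart_openin[OF N d]])
  then have "openin (mtop M) (fst c \<inter> {x \<in> topspace (mtop M). \<psi> x \<in> fst d})"
    by (intro openin_Int chart_openin[OF M c])
  also have "fst c \<inter> {x \<in> topspace (mtop M). \<psi> x \<in> fst d} = fst c \<inter> \<psi> -` fst d"
    using chart_subset[OF M c] by auto
  finally have "openin (subtopology (mtop M) (fst c)) (fst c \<inter> \<psi> -` fst d)"
    by (simp add: openin_open_subtopology chart_openin[OF M c])
  then have "openin (top_of_set (snd c ` fst c)) (snd c ` (fst c \<inter> \<psi> -` fst d))"
    using homeomorphic_imp_open_map[OF chart_homeomorphic[OF M c]] by (simp add: open_map_def)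
  then show ?thesis
    unfolding local_dom_def using openin_open_eq[OF chart_open_image[OF M c]] by blast
qed

lemma metric_patch:
  assumes M: "riemannian_manifold M" and c: "c \<in> charts M" and S: "open S" "S \<subseteq> snd c ` fst c"
  shows "riemannian_patch S (metric M c)"
proof (rule riemannian_patch.intro)
  show "smooth_on S (metric M c)"
    using M c S(2) smooth_on_subset unfolding riemannian_manifold_def by blast
  show "inner_product_matrix (metric M c z)" if "z \<in> S" for z
    using M c S(2) that unfolding riemannian_manifold_def by unfold_locales blast+
qed (rule S(1))

lemma isometric_immersion_patch:
  assumes N: "riemannian_manifold N" and M: "riemannian_manifold M" and \<psi>: "isometric_immersion M N \<psi>"
    and c: "c \<in> charts M" and d: "d \<in> charts N"
  shows "isometric_patch (snd d ` fst d) (metric N d) (local_dom c d \<psi>) (metric M c) (local_rep c d \<psi>)"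
proof -
  have M': "smooth_manifold M" and N': "smooth_manifold N"
    using M N by (simp_all add: riemannian_manifold_def)
  have \<psi>': "continuous_map (mtop M) (mtop N) \<psi>" "smooth_on (local_dom c d \<psi>) (local_rep c d \<psi>)"
    using \<psi> c d by (simp_all add: isometric_immersion_def smooth_map_def)
  have S: "open (local_dom c d \<psi>)" by (rule open_local_dom[OF M' N' \<psi>'(1) c d])
  have "local_dom c d \<psi> \<subseteq> snd c ` fst c" by (auto simp: local_dom_def)
  then interpret src: riemannian_patch "local_dom c d \<psi>" "metric M c"
    by (rule metric_patch[OF M c S])
  interpret tgt: riemannian_patch "snd d ` fst d" "metric N d"
    by (rule metric_patch[OF N d chart_open_image[OF N' d] order_refl])
  show ?thesis
  proof
    show "local_rep c d \<psi> x \<in> snd d ` fst d" if x: "x \<in> local_dom c d \<psi>" for x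
    proof -
      obtain q where "x = snd c q" "(c, d) \<in> charts_around M N \<psi> q"
        using local_domE[OF x c d] .
      then show ?thesis
        using local_rep_chart[OF M', of c d N \<psi> q] by (simp add: charts_around_def)
    qed
    show "ip (metric N d (local_rep c d \<psi> x)) (diff_at (local_rep c d \<psi>) x u) (diff_at (local_rep c d \<psi>) x v)
        = ip (metric M c x) u v" if "x \<in> local_dom c d \<psi>" for x u v
      using \<psi> c d that unfolding isometric_immersion_def by metis
  qed (simp_all add: S \<psi>' smooth_on_id)
qed

lemma cmc_immersion_patch:
  fixes N :: "('b, 'n::finite) almost_hermitian" and M :: "('a, 'm::finite) riemannian"
  assumes N: "generalized_complex_space_form N \<alpha> \<beta>" and M: "riemannian_manifold M"
    and \<psi>: "isometric_immersion M N \<psi>" and H: "constant_mean_curvature M N \<psi> H" "H \<noteq> 0"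
    and codim: "CARD('n) = CARD('m) + 1"
    and c: "c \<in> charts M" and d: "d \<in> charts N"
  shows "cmc_hypersurface_in_space_form_patch (snd d ` fst d) (metric N d) (local_dom c d \<psi>)
    (metric M c) (local_rep c d \<psi>) ((real CARD('m) * H)\<^sup>2) (acs N d) (\<alpha> \<circ> chart_inv d) (\<beta> \<circ> chart_inv d)"
proof -
  have hermitian: "almost_hermitian_manifold N" and N': "riemannian_manifold N"
    using N by (simp_all add: generalized_complex_space_form_def almost_hermitian_manifold_def)
  have N'': "smooth_manifold N" using N' by (simp add: riemannian_manifold_def)
  interpret isometric_patch "snd d ` fst d" "metric N d" "local_dom c d \<psi>" "metric M c" "local_rep c d \<psi>"
    by (rule isometric_immersion_patch[OF N' M \<psi> c d])
  show ?thesis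
  proof
    show "ip (metric N d (local_rep c d \<psi> x)) (\<tau> x) (\<tau> x) = (real CARD('m) * H)\<^sup>2"
      if x: "x \<in> local_dom c d \<psi>" for x
    proof -
      obtain q where q: "x = snd c q" "(c, d) \<in> charts_around M N \<psi> q"
        using local_domE[OF x c d] .
      then have "q \<in> topspace (mtop M)"
        using chart_subset[of M c] c M by (auto simp: charts_around_def riemannian_manifold_def)
      with q H(1) show ?thesis
        by (intro mean_curvature_length_eq[OF x]) (auto simp: constant_mean_curvature_def)
    qed
    fix z assume z: "z \<in> snd d ` fst d"
    then show "acs N d z *v (acs N d z *v u) = - u"
      and "ip (metric N d z) (acs N d z *v u) (acs N d z *v v) = ip (metric N d z) u v" for u v
      using hermitian d unfolding almost_hermitian_manifold_def by blast+
    show "curvature (metric N d) z u v w = (\<alpha> \<circ> chart_inv d) z *\<^sub>R R1 (metric N d z) u v w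
        + (\<beta> \<circ> chart_inv d) z *\<^sub>R R2 (metric N d z) (acs N d z) u v w" for u v w
      using z N d by (auto simp: generalized_complex_space_form_def chart_inv_chart[OF N'' d])
  qed (use H(2) codim in simp_all)
qed

theorem proposition3p5:
  fixes N :: "('b, 4) almost_hermitian" and \<alpha> \<beta> :: "'b \<Rightarrow> real"
    and M :: "('a, 3) riemannian" and \<psi> :: "'a \<Rightarrow> 'b" and H :: real
  assumes "generalized_complex_space_form N \<alpha> \<beta>"
    and "riemannian_manifold M"
    and "isometric_immersion M N \<psi>"
    and "constant_mean_curvature M N \<psi> H"
    and "H \<noteq> 0"
  shows
    "(proper_biharmonic M N \<psi> \<longleftrightarrow>
       (\<forall>p\<in>topspace (mtop M). \<forall>(c, d)\<in>charts_around M N \<psi> p.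
          second_fundamental_form_norm_sq (metric M c) (metric N d) (local_rep c d \<psi>) (snd c p)
            = 3 * (\<alpha> (\<psi> p) + \<beta> (\<psi> p)))) \<and>
     (proper_biharmonic M N \<psi> \<longleftrightarrow>
       (\<forall>p\<in>topspace (mtop M). \<forall>c\<in>charts M. p \<in> fst c \<longrightarrow>
          scalar_curvature (metric M c) (snd c p)
            = 3 * (\<alpha> (\<psi> p) + \<beta> (\<psi> p)) + 9 * H\<^sup>2))"
proof -
  have M: "smooth_manifold M" and N: "smooth_manifold N"
    using assms(1,2) by (simp_all add: generalized_complex_space_form_def almost_hermitian_manifold_def
        riemannian_manifold_def)
  have \<psi>: "\<psi> p \<in> topspace (mtop N)" if "p \<in> topspace (mtop M)" for p
    using assms(3) that
    by (auto simp: isometric_immersion_def smooth_map_def continuous_map_def)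
  have around: "\<exists>d. (c, d) \<in> charts_around M N \<psi> p" if "p \<in> topspace (mtop M)" "c \<in> charts M" "p \<in> fst c" for p c
    using chart_exists[OF N \<psi>[OF that(1)]] that by (auto simp: charts_around_def)
  have pointwise:
    "tension_field (metric M c) (metric N d) (local_rep c d \<psi>) (snd c p) \<noteq> 0"
    "bitension_field (metric M c) (metric N d) (local_rep c d \<psi>) (snd c p) = 0 \<longleftrightarrow>
       second_fundamental_form_norm_sq (metric M c) (metric N d) (local_rep c d \<psi>) (snd c p)
         = 3 * (\<alpha> (\<psi> p) + \<beta> (\<psi> p))"
    "scalar_curvature (metric M c) (snd c p) = 3 * (\<alpha> (\<psi> p) + \<beta> (\<psi> p)) + 9 * H\<^sup>2 \<longleftrightarrow>
       second_fundamental_form_norm_sq (metric M c) (metric N d) (local_rep c d \<psi>) (snd c p)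
         = 3 * (\<alpha> (\<psi> p) + \<beta> (\<psi> p))"
    if cd: "(c, d) \<in> charts_around M N \<psi> p" for c d p
  proof -
    have c: "c \<in> charts M" and d: "d \<in> charts N" and p: "\<psi> p \<in> fst d"
      using cd by (auto simp: charts_around_def)
    interpret cmc_hypersurface_in_space_form_patch "snd d ` fst d" "metric N d" "local_dom c d \<psi>"
      "metric M c" "local_rep c d \<psi>" "(real CARD(3) * H)\<^sup>2" "acs N d" "\<alpha> \<circ> chart_inv d" "\<beta> \<circ> chart_inv d"
      by (rule cmc_immersion_patch[OF assms _ c d]) simp
    note x = in_local_dom[OF cd]
    have F: "chart_inv d (local_rep c d \<psi> (snd c p)) = \<psi> p"
      by (simp add: local_rep_chart[OF M cd] chart_inv_chart[OF N d p])
    \<comment> \<open>The squared length of the tension field is \<open>9 H\<^sup>2 > 0\<close>.\<close>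
    show nz: "\<tau> (snd c p) \<noteq> 0"
      using tension_length[OF x] k_pos by (auto simp: ip_simps)
    show "bitension_field (metric M c) (metric N d) (local_rep c d \<psi>) (snd c p) = 0 \<longleftrightarrow>
       second_fundamental_form_norm_sq (metric M c) (metric N d) (local_rep c d \<psi>) (snd c p)
         = 3 * (\<alpha> (\<psi> p) + \<beta> (\<psi> p))"
      using nz by (simp add: bitension_field_eq[OF x] F) argo
    show "scalar_curvature (metric M c) (snd c p) = 3 * (\<alpha> (\<psi> p) + \<beta> (\<psi> p)) + 9 * H\<^sup>2 \<longleftrightarrow>
       second_fundamental_form_norm_sq (metric M c) (metric N d) (local_rep c d \<psi>) (snd c p)
         = 3 * (\<alpha> (\<psi> p) + \<beta> (\<psi> p))"
      by (simp add: scalar_curvature_eq[OF x] F power_mult_distrib) argo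
  qed
  have "\<not> harmonic M N \<psi>"
  proof -
    obtain p where p: "p \<in> topspace (mtop M)" using M unfolding smooth_manifold_def by blast
    then obtain c d where "(c, d) \<in> charts_around M N \<psi> p"
      using chart_exists[OF M p] around by blast
    then show ?thesis using p pointwise(1) unfolding harmonic_def by blast
  qed
  then have "proper_biharmonic M N \<psi> \<longleftrightarrow>
      (\<forall>p\<in>topspace (mtop M). \<forall>(c, d)\<in>charts_around M N \<psi> p.
        second_fundamental_form_norm_sq (metric M c) (metric N d) (local_rep c d \<psi>) (snd c p)
          = 3 * (\<alpha> (\<psi> p) + \<beta> (\<psi> p)))" (is "_ \<longleftrightarrow> ?norm")
    unfolding proper_biharmonic_def biharmonic_def using pointwise(2) by (simp add: split_beta)
  moreover have "?norm \<longleftrightarrow> (\<forall>p\<in>topspace (mtop M). \<forall>c\<in>charts M. p \<in> fst c \<longrightarrow>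
      scalar_curvature (metric M c) (snd c p) = 3 * (\<alpha> (\<psi> p) + \<beta> (\<psi> p)) + 9 * H\<^sup>2)" (is "_ \<longleftrightarrow> ?scal")
  proof
    assume ?norm
    then show ?scal using around pointwise(3) by blast
  next
    assume ?scal
    have "second_fundamental_form_norm_sq (metric M c) (metric N d) (local_rep c d \<psi>) (snd c p)
        = 3 * (\<alpha> (\<psi> p) + \<beta> (\<psi> p))"
      if p: "p \<in> topspace (mtop M)" and cd: "(c, d) \<in> charts_around M N \<psi> p" for p c d
    proof -
      have "c \<in> charts M" "p \<in> fst c" using cd by (auto simp: charts_around_def)
      then show ?thesis using \<open>?scal\<close> p pointwise(3)[OF cd] by blast
    qed
    then show ?norm by blast
  qed
  ultimately show ?thesis by blast
qed

end
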